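(* Let $n>20$ be an integer, let $X_n$ be the blow-up of $\mathbb{P}^n$ in two points, and let $E$ be a (nonempty) strongly exceptional collection of line bundles on $X_n$. Write every line bundle in $E$ in coordinates $(a,b,c)$, meaning $aD_y+bD_t+cD_u$. Let $a_0$ be the minimum of the first coordinates $a$ of the line bundles in $E$, and let $k$ be the number of distinct integers $a>a_0+n$ that occur as the first coordinate of some line bundle in $E$. Then the number $|E|$ of line bundles in $E$ satisfies $$|E|\;\leq\; k+1+\tfrac{8}{3}(n-k-1)+6+k+2\;\leq\;\tfrac{8}{3}n-\tfrac{2}{3}k+\tfrac{19}{3},$$ where the last expression is strictly smaller than $3n-1$ whenever $k\geq 1$. Moreover, in all cases $|E|<3n-1$.
   Context: Varieties are over $\mathbb{C}$. For $n\geq 2$, $X_n$ is the smooth complete toric variety of dimension $n$ whose rays in $\mathbb{Z}^n$ (standard basis $e_1,\dots,e_n$) are $y_i=e_i$ ($1\leq i\leq n-1$), $z=e_n$, $t=-e_n$, $u=e_1+\dots+e_n$, $v=-u$, and whose fan has primitive collections (minimal sets of rays not spanning a cone) $\{v,y_1,\dots,y_{n-1}\}$, $\{y_1,\dots,y_{n-1},z\}$, $\{z,t\}$, $\{t,u\}$, $\{u,v\}$. It is $\mathbb{P}^n$ blown up in two points and has Picard number $3$. Let $D_v,D_z,D_t,D_u$ be the classes of the corresponding torus-invariant divisors and $D_y$ the common class of the divisors of $y_1,\dots,y_{n-1}$. Then $D_z=D_t+D_y$, $D_v=D_u+D_y$, and $D_y,D_t,D_u$ is a basis of $\mathrm{Pic}(X_n)$;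 the line bundle (divisor class) $aD_y+bD_t+cD_u$ is denoted $(a,b,c)\in\mathbb{Z}^3$. A strongly exceptional collection of line bundles is a finite sequence $L_1,\dots,L_m$ of distinct line bundles with $\mathrm{Ext}^i(L_p,L_q)=0$ for all $p,q$ and all $i>0$, and $\mathrm{Hom}(L_p,L_q)=0$ for $p>q$. *)

theory Defs
  imports Complex_Main "HOL-Library.Poly_Mapping"
begin

section \<open>The fan of the blow-up of projective space in two points\<close>

text \<open>
  Lattice points of \<open>M = \<int>\<^sup>n\<close> (and of the dual lattice) are indexed by the coordinates \<open>1, \<dots>, n\<close>.
  The ray called \<open>y\<^sub>i\<close> is \<open>Ry i\<close>; only \<open>Ry 1, \<dots>, Ry (n - 1)\<close> are rays of the fan.
\<close>

datatype ray = Ry nat | Rz | Rt | Ru | Rv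

definition y_rays :: "nat \<Rightarrow> ray set" where
  "y_rays n = Ry ` {1..n - 1}"

definition rays :: "nat \<Rightarrow> ray set" where
  "rays n = y_rays n \<union> {Rz, Rt, Ru, Rv}"

fun ray_gen :: "nat \<Rightarrow> ray \<Rightarrow> nat \<Rightarrow> int" where
  "ray_gen n (Ry j) i = (if i = j then 1 else 0)"
| "ray_gen n Rz i = (if i = n then 1 else 0)"
| "ray_gen n Rt i = (if i = n then - 1 else 0)"
| "ray_gen n Ru i = (if i \<in> {1..n} then 1 else 0)"
| "ray_gen n Rv i = (if i \<in> {1..n} then - 1 else 0)"

definition primitive_collections :: "nat \<Rightarrow> ray set set" where
  "primitive_collections n =
     {insert Rv (y_rays n), insert Rz (y_rays n), {Rz, Rt}, {Rt, Ru}, {Ru, Rv}}"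

text \<open>A cone of the (simplicial) fan is represented by the set of its rays.\<close>

definition cones :: "nat \<Rightarrow> ray set set" where
  "cones n = {\<sigma>. \<sigma> \<subseteq> rays n \<and> (\<forall>P \<in> primitive_collections n. \<not> P \<subseteq> \<sigma>)}"

definition max_cones :: "nat \<Rightarrow> ray set set" where
  "max_cones n = {\<sigma> \<in> cones n. \<forall>\<tau> \<in> cones n. \<sigma> \<subseteq> \<tau> \<longrightarrow> \<tau> = \<sigma>}"


section \<open>Torus-invariant divisors and their classes\<close>

definition char_lattice :: "nat \<Rightarrow> (nat \<Rightarrow>\<^sub>0 int) set" where
  "char_lattice n = {m. Poly_Mapping.keys m \<subseteq> {1..n}}"

definition pairing :: "nat \<Rightarrow> (nat \<Rightarrow>\<^sub>0 int) \<Rightarrow> ray \<Rightarrow> int" where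
  "pairing n m \<rho> = (\<Sum>i = 1..n. Poly_Mapping.lookup m i * ray_gen n \<rho> i)"

text \<open>
  A torus-invariant divisor \<open>\<Sum> D \<rho> \<cdot> D\<^sub>\<rho>\<close> is given by its coefficients on the rays. As
  \<open>div \<chi>\<^sup>m = \<Sum> \<langle>m, u\<^sub>\<rho>\<rangle> \<cdot> D\<^sub>\<rho>\<close>, the following relation is linear equivalence, that is, isomorphism
  of the line bundles \<open>O(D)\<close> and \<open>O(D')\<close>. On a smooth complete toric variety every line bundle is
  isomorphic to some \<open>O(D)\<close>.
\<close>

type_synonym divisor = "ray \<Rightarrow> int"

definition lin_equiv :: "nat \<Rightarrow> divisor \<Rightarrow> divisor \<Rightarrow> bool" where
  "lin_equiv n D D' \<longleftrightarrow> (\<exists>m \<in> char_lattice n. \<forall>\<rho> \<in> rays n. D' \<rho> - D \<rho> = pairing n m \<rho>)"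

definition prime_div :: "ray \<Rightarrow> divisor" where
  "prime_div \<rho> = (\<lambda>\<rho>'. if \<rho>' = \<rho> then 1 else 0)"

text \<open>
  The line bundle with coordinates \<open>(a, b, c)\<close>, i.e. the class of \<open>a D\<^sub>y + b D\<^sub>t + c D\<^sub>u\<close>. The divisors
  of \<open>y\<^sub>1, \<dots>, y\<^sub>n\<^sub>-\<^sub>1\<close> are linearly equivalent (shown below); the class \<open>D\<^sub>y\<close> is represented by that
  of \<open>y\<^sub>1\<close>.
\<close>

fun line_bundle :: "int \<times> int \<times> int \<Rightarrow> divisor" where
  "line_bundle (a, b, c) =
     (\<lambda>\<rho>. a * prime_div (Ry 1) \<rho> + b * prime_div Rt \<rho> + c * prime_div Ru \<rho>)"


section \<open>Cohomology of line bundles and strongly exceptional collections\<close>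

text \<open>
  The group algebra \<open>\<complex>[M]\<close>, the coordinate ring of the torus: the exponent \<open>m\<close> stands for the
  character \<open>\<chi>\<^sup>m\<close>.
\<close>

type_synonym laurent = "(nat \<Rightarrow>\<^sub>0 int) \<Rightarrow>\<^sub>0 complex"

definition laurent_ring :: "nat \<Rightarrow> laurent set" where
  "laurent_ring n = {f. Poly_Mapping.keys f \<subseteq> char_lattice n}"

text \<open>
  Sections of \<open>O(D)\<close> over the affine chart \<open>U\<^sub>\<sigma>\<close>, i.e. the rational functions \<open>f\<close> with
  \<open>div f + D \<ge> 0\<close> on \<open>U\<^sub>\<sigma>\<close>. Such \<open>f\<close> are regular on the torus, hence lie in \<open>\<complex>[M]\<close>; the only prime
  divisors in the complement of the torus in \<open>U\<^sub>\<sigma>\<close> are the \<open>D\<^sub>\<rho>\<close> with \<open>\<rho>\<close> a ray of \<open>\<sigma>\<close>, and the order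
  of vanishing of \<open>f\<close> along \<open>D\<^sub>\<rho>\<close> is the minimum of \<open>\<langle>m, u\<^sub>\<rho>\<rangle>\<close> over the exponents \<open>m\<close> of \<open>f\<close>.
\<close>

definition sections :: "nat \<Rightarrow> divisor \<Rightarrow> ray set \<Rightarrow> laurent set" where
  "sections n D \<sigma> =
     {f \<in> laurent_ring n. \<forall>m \<in> Poly_Mapping.keys f. \<forall>\<rho> \<in> \<sigma>. pairing n m \<rho> + D \<rho> \<ge> 0}"

text \<open>
  The Cech complex of \<open>O(D)\<close> for the affine open cover \<open>{U\<^sub>\<sigma>}\<close>, \<open>\<sigma>\<close> a maximal cone, with cochains on
  all tuples \<open>(\<sigma>\<^sub>0, \<dots>, \<sigma>\<^sub>p)\<close> of maximal cones (not only alternating ones), extended by \<open>0\<close> to other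
  lists. Note that \<open>U\<^sub>\<sigma> \<inter> U\<^sub>\<tau> = U\<^bsub>\<sigma> \<inter> \<tau>\<^esub>\<close>, and that the restriction maps are inclusions inside \<open>\<complex>[M]\<close>.
\<close>

type_synonym cochain = "ray set list \<Rightarrow> laurent"

definition simplices :: "nat \<Rightarrow> nat \<Rightarrow> ray set list set" where
  "simplices n p = {s. length s = Suc p \<and> set s \<subseteq> max_cones n}"

definition cochains :: "nat \<Rightarrow> divisor \<Rightarrow> nat \<Rightarrow> cochain set" where
  "cochains n D p =
     {\<phi>. (\<forall>s \<in> simplices n p. \<phi> s \<in> sections n D (\<Inter>(set s))) \<and> (\<forall>s. s \<notin> simplices n p \<longrightarrow> \<phi> s = 0)}"

definition omit :: "nat \<Rightarrow> 'a list \<Rightarrow> 'a list" where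
  "omit j s = take j s @ drop (Suc j) s"

definition cech_d :: "nat \<Rightarrow> nat \<Rightarrow> cochain \<Rightarrow> cochain" where
  "cech_d n p \<phi> =
     (\<lambda>s. if s \<in> simplices n (Suc p) then \<Sum>j\<le>Suc p. (- 1) ^ j * \<phi> (omit j s) else 0)"

definition cocycles :: "nat \<Rightarrow> divisor \<Rightarrow> nat \<Rightarrow> cochain set" where
  "cocycles n D p = {\<phi> \<in> cochains n D p. cech_d n p \<phi> = (\<lambda>_. 0)}"

fun coboundaries :: "nat \<Rightarrow> divisor \<Rightarrow> nat \<Rightarrow> cochain set" where
  "coboundaries n D 0 = {\<lambda>_. 0}"
| "coboundaries n D (Suc p) = cech_d n p ` cochains n D p"

text \<open>\<open>H\<^sup>p(X\<^sub>n, O(D)) = 0\<close>: the quotient of the cocycles by the coboundaries is trivial.\<close>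

definition cohomology_zero :: "nat \<Rightarrow> divisor \<Rightarrow> nat \<Rightarrow> bool" where
  "cohomology_zero n D p \<longleftrightarrow> cocycles n D p \<subseteq> coboundaries n D p"

text \<open>
  \<open>Ext\<^sup>i(O(D), O(D')) = 0\<close>, where \<open>Ext\<^sup>i(L, L') = H\<^sup>i(X, L\<^sup>-\<^sup>1 \<otimes> L')\<close> for line bundles \<open>L\<close>, \<open>L'\<close>;
  in particular \<open>Hom\<close> is the case \<open>i = 0\<close>.
\<close>

definition Ext_zero :: "nat \<Rightarrow> nat \<Rightarrow> divisor \<Rightarrow> divisor \<Rightarrow> bool" where
  "Ext_zero n i D D' \<longleftrightarrow> cohomology_zero n (\<lambda>\<rho>. D' \<rho> - D \<rho>) i"

abbreviation Hom_zero :: "nat \<Rightarrow> divisor \<Rightarrow> divisor \<Rightarrow> bool" where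
  "Hom_zero n D D' \<equiv> Ext_zero n 0 D D'"

definition strongly_exceptional :: "nat \<Rightarrow> divisor list \<Rightarrow> bool" where
  "strongly_exceptional n L \<longleftrightarrow>
     (\<forall>p < length L. \<forall>q < length L. p \<noteq> q \<longrightarrow> \<not> lin_equiv n (L ! p) (L ! q)) \<and>
     (\<forall>p < length L. \<forall>q < length L. \<forall>i > 0. Ext_zero n i (L ! p) (L ! q)) \<and>
     (\<forall>p < length L. \<forall>q < p. Hom_zero n (L ! p) (L ! q))"


lemma omit_length: "j < length s \<Longrightarrow> length (omit j s) = length s - 1"
  by (simp add: omit_def)

lemma omit_nth:
  "j < length s \<Longrightarrow> l < length s - 1 \<Longrightarrow> omit j s ! l = (if l < j then s ! l else s ! Suc l)"
  by (simp add: omit_def nth_append)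

lemma omit_omit:
  assumes "j < i" "i < length s"
  shows "omit j (omit i s) = omit (i - 1) (omit j s)"
proof (rule nth_equalityI)
  have len: "length (omit i s) = length s - 1" "length (omit j s) = length s - 1"
    using assms by (simp_all add: omit_length)
  have len2: "length (omit j (omit i s)) = length s - 2"
      "length (omit (i - 1) (omit j s)) = length s - 2"
    using assms by (simp_all add: omit_length len)
  then show "length (omit j (omit i s)) = length (omit (i - 1) (omit j s))"
    by simp
  fix l
  assume "l < length (omit j (omit i s))"
  then have l: "Suc l < length s - 1"
    unfolding len2 by linarith
  have A: "omit j (omit i s) ! l = (if l < j then omit i s ! l else omit i s ! Suc l)"
    using assms l by (intro omit_nth) (simp_all add: len)
  have B: "omit (i - 1) (omit j s) ! l = (if l < i - 1 then omit j s ! l else omit j s ! Suc l)"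
    using assms l by (intro omit_nth) (simp_all add: len)
  have C: "omit i s ! l = (if l < i then s ! l else s ! Suc l)"
      "omit j s ! l = (if l < j then s ! l else s ! Suc l)"
      "omit i s ! Suc l = (if Suc l < i then s ! Suc l else s ! Suc (Suc l))"
      "omit j s ! Suc l = (if Suc l < j then s ! Suc l else s ! Suc (Suc l))"
    using assms l by (intro omit_nth; linarith)+
  have D: "l < i - 1 \<longleftrightarrow> Suc l < i"
    by linarith
  consider "l < j" "Suc l < i" "l < i" | "\<not> l < j" "Suc l < i" | "\<not> l < j" "\<not> Suc l < i"
    using assms(1) by linarith
  then show "omit j (omit i s) ! l = omit (i - 1) (omit j s) ! l"
    unfolding A B C D by cases simp_all
qed

lemma omit_simplices:
  assumes "s \<in> simplices n (Suc p)" "j \<le> Suc p"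
  shows "omit j s \<in> simplices n p"
  using assms set_take_subset[of j s] set_drop_subset[of "Suc j" s]
  by (auto simp: simplices_def omit_def)

lemma sections_mono: "\<tau> \<subseteq> \<sigma> \<Longrightarrow> sections n D \<sigma> \<subseteq> sections n D \<tau>"
  by (auto simp: sections_def)

lemma sections_add: "f \<in> sections n D \<sigma> \<Longrightarrow> g \<in> sections n D \<sigma> \<Longrightarrow> f + g \<in> sections n D \<sigma>"
  unfolding sections_def laurent_ring_def using Poly_Mapping.keys_add[of f g] by blast

lemma sections_minus: "f \<in> sections n D \<sigma> \<Longrightarrow> - f \<in> sections n D \<sigma>"
  by (auto simp: sections_def laurent_ring_def)

lemma sections_sign: "f \<in> sections n D \<sigma> \<Longrightarrow> (- 1) ^ j * f \<in> sections n D \<sigma>"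
  by (cases "even j") (simp_all add: sections_minus)

lemma sections_zero: "0 \<in> sections n D \<sigma>"
  by (simp add: sections_def laurent_ring_def)

lemma sections_sum:
  assumes "\<And>j. j \<in> A \<Longrightarrow> F j \<in> sections n D \<sigma>"
  shows "sum F A \<in> sections n D \<sigma>"
  using assms
proof (induction A rule: infinite_finite_induct)
  case (insert x A)
  then show ?case
    unfolding sum.insert[OF insert.hyps] by (blast intro: sections_add)
qed (simp_all only: sum.infinite sum.empty sections_zero not_False_eq_True)

lemma cech_d_cochains:
  assumes "\<phi> \<in> cochains n D p"
  shows "cech_d n p \<phi> \<in> cochains n D (Suc p)"
proof -
  have *: "\<phi> (omit j s) \<in> sections n D (\<Inter>(set s))"
    if "s \<in> simplices n (Suc p)" "j \<le> Suc p" for s j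
  proof -
    have 1: "\<phi> (omit j s) \<in> sections n D (\<Inter>(set (omit j s)))"
      using assms omit_simplices[OF that] unfolding cochains_def by blast
    have "set (omit j s) \<subseteq> set s"
      unfolding omit_def set_append using set_take_subset[of j s] set_drop_subset[of "Suc j" s]
      by blast
    then have "\<Inter>(set (omit j s)) \<supseteq> \<Inter>(set s)"
      by (rule Inter_anti_mono)
    then show ?thesis
      using 1 sections_mono by blast
  qed
  have "cech_d n p \<phi> s \<in> sections n D (\<Inter>(set s))" if s: "s \<in> simplices n (Suc p)" for s
    unfolding cech_d_def if_P[OF s]
    by (rule sections_sum, rule sections_sign, rule *[OF s]) simp
  moreover have "cech_d n p \<phi> s = 0" if "s \<notin> simplices n (Suc p)" for s
    unfolding cech_d_def if_not_P[OF that] ..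
  ultimately show ?thesis
    unfolding cochains_def by blast
qed

lemma cech_d_d: "cech_d n (Suc p) (cech_d n p \<phi>) s = 0"
proof (cases "s \<in> simplices n (Suc (Suc p))")
  case True
  define f where "f = (\<lambda>(i, j). (- 1) ^ (i + j) * \<phi> (omit j (omit i s)))"
  define A where "A = {..Suc (Suc p)} \<times> {..Suc p}"
  define B C where "B = {x \<in> A. snd x < fst x}" and "C = {x \<in> A. \<not> snd x < fst x}"
  have fin: "finite B" "finite C"
    by (auto simp: A_def B_def C_def)
  have "cech_d n (Suc p) (cech_d n p \<phi>) s = sum f A"
  proof -
    have "cech_d n p \<phi> (omit i s) = (\<Sum>j\<le>Suc p. (- 1) ^ j * \<phi> (omit j (omit i s)))"
      if "i \<le> Suc (Suc p)" for i
      using omit_simplices[OF True that] by (simp add: cech_d_def)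
    then have "cech_d n (Suc p) (cech_d n p \<phi>) s =
        (\<Sum>i\<le>Suc (Suc p). (- 1) ^ i * (\<Sum>j\<le>Suc p. (- 1) ^ j * \<phi> (omit j (omit i s))))"
      using True unfolding cech_d_def[of n "Suc p"] by (auto intro!: sum.cong)
    then show ?thesis
      by (simp only: f_def A_def sum.cartesian_product[symmetric] sum_distrib_left power_add
          mult.assoc prod.case)
  qed
  also have "A = B \<union> C"
    by (auto simp: B_def C_def)
  also have "sum f (B \<union> C) = sum f B + sum f C"
    by (rule sum.union_disjoint) (use fin in \<open>auto simp: B_def C_def\<close>)
  also have "sum f B = sum (\<lambda>x. - f x) C"
  proof (rule sum.reindex_bij_witness[where i = "\<lambda>(i, j). (Suc j, i)" and j = "\<lambda>(i, j). (j, i - 1)"])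
    fix x
    assume x: "x \<in> B"
    obtain i j where [simp]: "x = (i, j)"
      by (cases x)
    have "j < i" "i < length s"
      using x True by (auto simp: A_def B_def simplices_def)
    then show "- f (case x of (i, j) \<Rightarrow> (j, i - 1)) = f x"
      using omit_omit[of j i s] by (cases i) (auto simp: f_def add.commute)
  qed (auto simp: A_def B_def C_def)
  finally show ?thesis
    by (simp add: sum_negf)
qed (simp add: cech_d_def)

lemma coboundaries_subset_cocycles: "coboundaries n D p \<subseteq> cocycles n D p"
proof (cases p)
  case 0
  then show ?thesis
    by (auto simp: cocycles_def cochains_def cech_d_def sections_def laurent_ring_def)
next
  case (Suc q)
  then show ?thesis
    using cech_d_cochains by (auto simp: cocycles_def cech_d_d)
qed


section \<open>The coordinates on the Picard group\<close>

lemma pairing_simps: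
  "j \<in> {1..n} \<Longrightarrow> pairing n m (Ry j) = Poly_Mapping.lookup m j"
  "n \<ge> 1 \<Longrightarrow> pairing n m Rz = Poly_Mapping.lookup m n"
  "n \<ge> 1 \<Longrightarrow> pairing n m Rt = - Poly_Mapping.lookup m n"
  "pairing n m Ru = (\<Sum>i = 1..n. Poly_Mapping.lookup m i)"
  "pairing n m Rv = - (\<Sum>i = 1..n. Poly_Mapping.lookup m i)"
  by (simp_all add: pairing_def if_distrib sum_negf cong: if_cong)

lemma ball_rays:
  "(\<forall>\<rho> \<in> rays n. Q \<rho>) \<longleftrightarrow> (\<forall>j \<in> {1..n - 1}. Q (Ry j)) \<and> Q Rz \<and> Q Rt \<and> Q Ru \<and> Q Rv"
  by (auto simp: rays_def y_rays_def)

lemma lin_equiv_iff: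
  assumes "n \<ge> 2"
  shows "lin_equiv n D D' \<longleftrightarrow>
    (\<Sum>j = 1..n - 1. D' (Ry j) - D (Ry j)) + (D' Rz - D Rz) = D' Ru - D Ru \<and>
    D' Rt - D Rt = - (D' Rz - D Rz) \<and> D' Rv - D Rv = - (D' Ru - D Ru)"
    (is "_ \<longleftrightarrow> ?R")
proof -
  have n1: "Suc 0 \<le> n"
    using assms by simp
  have split: "(\<Sum>i = 1..n. f i) = (\<Sum>i = 1..n - 1. f i) + f n" for f :: "nat \<Rightarrow> int"
    using assms sum.nat_ivl_Suc'[of 1 "n - 1" f] by simp
  show ?thesis
  proof
    assume "lin_equiv n D D'"
    then obtain m where m: "\<forall>\<rho> \<in> rays n. D' \<rho> - D \<rho> = pairing n m \<rho>"
      by (auto simp: lin_equiv_def)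
    have "(\<Sum>j = 1..n - 1. D' (Ry j) - D (Ry j)) = (\<Sum>j = 1..n - 1. Poly_Mapping.lookup m j)"
      using m by (intro sum.cong) (auto simp: ball_rays pairing_simps)
    then show ?R
      using m assms by (auto simp: ball_rays pairing_simps split simp del: One_nat_def)
  next
    assume R: ?R
    define g where "g i = (if i \<in> {1..n - 1} then D' (Ry i) - D (Ry i)
      else if i = n then D' Rz - D Rz else 0)" for i
    have "finite {i. g i \<noteq> 0}"
      by (rule finite_subset[of _ "{1..n}"]) (use n1 in \<open>auto simp: g_def\<close>)
    then have look: "Poly_Mapping.lookup (Abs_poly_mapping g) = g"
      by (simp add: Abs_poly_mapping_inverse)
    have gn: "g n = D' Rz - D Rz"
      using assms by (auto simp: g_def)
    have "(\<Sum>i = 1..n - 1. g i) = (\<Sum>j = 1..n - 1. D' (Ry j) - D (Ry j))"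
      by (intro sum.cong) (auto simp: g_def)
    then have "\<forall>\<rho> \<in> rays n. D' \<rho> - D \<rho> = pairing n (Abs_poly_mapping g) \<rho>"
      using R assms by (auto simp: ball_rays pairing_simps look split gn simp del: One_nat_def)
        (auto simp: g_def)
    moreover have "Abs_poly_mapping g \<in> char_lattice n"
      using n1 by (auto simp: char_lattice_def in_keys_iff look g_def split: if_splits)
    ultimately show "lin_equiv n D D'"
      unfolding lin_equiv_def by blast
  qed
qed

lemma lin_equiv_y:
  assumes "n \<ge> 2" "j \<in> {1..n - 1}"
  shows "lin_equiv n (prime_div (Ry j)) (prime_div (Ry 1))"
  using assms by (simp add: lin_equiv_iff prime_div_def sum_subtractf)

lemma lin_equiv_z_v:
  assumes "n \<ge> 2"
  shows "lin_equiv n (prime_div Rz) (line_bundle (1, 1, 0))"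
    and "lin_equiv n (prime_div Rv) (line_bundle (1, 0, 1))"
  using assms by (simp_all add: lin_equiv_iff prime_div_def)

lemma line_bundle_basis:
  assumes "n \<ge> 2"
  shows "\<exists>!abc. lin_equiv n D (line_bundle abc)"
proof -
  have "(\<Sum>j = 1..n - 1. a * (if j = 1 then 1 else 0)) = a" for a :: int
  proof -
    have "Suc 0 \<le> n - Suc 0"
      using assms by simp
    then show ?thesis
      by (simp add: if_distrib[of "(*) a"] cong: if_cong)
  qed
  then have *: "lin_equiv n D (line_bundle (a, b, c)) \<longleftrightarrow>
      (a, b, c) = ((\<Sum>j = 1..n - 1. D (Ry j)) + D Rz + D Rv, D Rt + D Rz, D Ru + D Rv)" for a b c
    using assms by (auto simp: lin_equiv_iff prime_div_def sum_subtractf simp del: One_nat_def)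
  show ?thesis
    by (rule ex1I[of _ "((\<Sum>j = 1..n - 1. D (Ry j)) + D Rz + D Rv, D Rt + D Rz, D Ru + D Rv)"])
      (use * in \<open>force simp del: One_nat_def line_bundle.simps\<close>)+
qed

end

theory Submission
  imports Defs
begin

text \<open>
  The degree-\<open>m\<close> part of the Cech complex of \<open>O(D)\<close> only depends on the set \<open>I\<close> of rays on which
  \<open>D + div \<chi>\<^sup>m\<close> is negative; it computes the reduced cohomology, shifted by one, of the subcomplex
  of the fan spanned by \<open>I\<close>. If that subcomplex is a homology sphere, then a labelling of the
  maximal cones maps it to the boundary of a simplex and yields a nontrivial class. This confines
  the differences \<open>(a, b, c)\<close> of the bundles of the collection.

  Two bundles with the same \<open>a\<close> differ in \<open>(b, c)\<close> by a root of \<open>A\<^sub>2\<close>, so each level has at most three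
  bundles; a level with three is a triangle, and three consecutive levels cannot all be full.
  A bundle more than \<open>n\<close> levels above a given one has \<open>b\<close> or \<open>c\<close> larger by exactly one. Hence,
  up to exchanging \<open>b\<close> and \<open>c\<close>, the \<open>k\<close> top levels lie in one slice of constant \<open>b\<close>, and the
  \<open>k\<close> lowest levels in another one; such a slice has at most one bundle more than levels. This
  gives at most \<open>2 (k + 1)\<close> bundles on these levels, and the \<open>n + 1 - k\<close> levels in between have at
  most 8 bundles on any three consecutive ones.
\<close>

section \<open>Alternating sums over lists\<close>

text \<open>The scalar Cech differential on arbitrary lists, detached from the fan, so that it
  serves both for lists of maximal cones and for lists of their labels.\<close>

definition list_d :: "('a list \<Rightarrow> 'b::comm_ring_1) \<Rightarrow> 'a list \<Rightarrow> 'b" where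
  "list_d f s = (\<Sum>j<length s. (- 1) ^ j * f (omit j s))"

lemma in_set_omit:
  assumes "x \<in> set (omit j s)"
  obtains l where "l < length s" "l \<noteq> j" "x = s ! l"
proof -
  from assms consider "x \<in> set (take j s)" | "x \<in> set (drop (Suc j) s)"
    by (auto simp: omit_def)
  then show ?thesis
  proof cases
    case 1
    then show ?thesis
      using that by (force simp: in_set_conv_nth)
  next
    case 2
    then obtain i where "i < length s - Suc j" "x = s ! (Suc j + i)"
      by (force simp: in_set_conv_nth)
    then show ?thesis
      using that[of "Suc j + i"] by simp
  qed
qed

lemma set_omit_subset: "set (omit j s) \<subseteq> set s"
  by (auto elim: in_set_omit)

lemma map_omit: "map f (omit j s) = omit j (map f s)"
  by (simp add: omit_def take_map drop_map)

lemma list_d_cong: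
  assumes "\<And>j. j < length s \<Longrightarrow> f (omit j s) = g (omit j s)"
  shows "list_d f s = list_d g s"
  unfolding list_d_def using assms by (intro sum.cong) auto

lemma list_d_eq_0:
  assumes "\<And>j. j < length s \<Longrightarrow> f (omit j s) = 0"
  shows "list_d f s = 0"
  unfolding list_d_def using assms by (intro sum.neutral) auto

lemma list_d_diff: "list_d (\<lambda>t. f t - g t) s = list_d f s - list_d g s"
  by (simp add: list_d_def right_diff_distrib sum_subtractf)

lemma list_d_map: "list_d (\<lambda>t. f (map q t)) s = list_d f (map q s)"
  by (simp add: list_d_def map_omit)

text \<open>Pairs of successive omissions cancel: (i, j) with j < i and (j, i - 1) leave the same
  list by \<open>omit_omit\<close> and carry opposite signs.\<close>

lemma list_d_list_d: "list_d (list_d f) s = 0"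
proof -
  define g where "g = (\<lambda>(i, j). (- 1) ^ (i + j) * f (omit j (omit i s)))"
  define A where "A = {..<length s} \<times> {..<length s - 1}"
  define B C where "B = {x \<in> A. snd x < fst x}" and "C = {x \<in> A. \<not> snd x < fst x}"
  have fin: "finite B" "finite C"
    by (auto simp: A_def B_def C_def)
  have "list_d f (omit i s) = (\<Sum>j<length s - 1. (- 1) ^ j * f (omit j (omit i s)))"
    if "i < length s" for i
    using that by (simp add: list_d_def omit_length)
  then have "list_d (list_d f) s =
      (\<Sum>i<length s. (- 1) ^ i * (\<Sum>j<length s - 1. (- 1) ^ j * f (omit j (omit i s))))"
    unfolding list_d_def[of "list_d f"] by (intro sum.cong) auto
  also have "\<dots> = sum g A"
    by (simp only: g_def A_def sum.cartesian_product[symmetric] sum_distrib_left power_add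
        mult.assoc prod.case)
  also have "A = B \<union> C"
    by (auto simp: B_def C_def)
  also have "sum g (B \<union> C) = sum g B + sum g C"
    by (rule sum.union_disjoint) (use fin in \<open>auto simp: B_def C_def\<close>)
  also have "sum g B = sum (\<lambda>x. - g x) C"
  proof (rule sum.reindex_bij_witness[where i = "\<lambda>(i, j). (Suc j, i)" and j = "\<lambda>(i, j). (j, i - 1)"])
    fix x
    assume x: "x \<in> B"
    obtain i j where [simp]: "x = (i, j)"
      by (cases x)
    have "j < i" "i < length s"
      using x by (auto simp: A_def B_def)
    then show "- g (case x of (i, j) \<Rightarrow> (j, i - 1)) = g x"
      using omit_omit[of j i s] by (cases i) (auto simp: g_def add.commute)
  qed (auto simp: A_def B_def C_def)
  finally show ?thesis
    by (simp add: sum_negf)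
qed

text \<open>
  The fundamental cocycle of the simplex on \<open>{0..p}\<close> relative to its boundary: the extension by
  zero of the cocycle of the facet opposite to a vertex has a coboundary that vanishes on the
  whole boundary.
\<close>

fun simplex_cocycle :: "nat \<Rightarrow> nat list \<Rightarrow> complex" where
  "simplex_cocycle 0 s = (if s = [0] then 1 else 0)"
| "simplex_cocycle (Suc p) s =
     list_d (\<lambda>t. if set t \<subseteq> {..p} then simplex_cocycle p t else 0) s"

text \<open>For p > 0 the function is itself a coboundary; for p = 0 the only list of two labels is
  [0, 0], whose two faces cancel.\<close>

lemma simplex_cocycle_closed:
  assumes "set s \<subseteq> {..p}"
  shows "list_d (simplex_cocycle p) s = 0"
proof (cases p)
  case 0
  show ?thesis
  proof (cases "length s = 2")
    case True
    then have "s = [0, 0]"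
      using assms 0 by (auto simp: length_Suc_conv numeral_2_eq_2)
    then show ?thesis
      by (simp add: 0 list_d_def omit_def)
  next
    case False
    have "omit j s \<noteq> [0]" if "j < length s" for j
      using False omit_length[OF that] by auto
    then show ?thesis
      by (intro list_d_eq_0) (simp add: 0)
  qed
next
  case (Suc r)
  have "simplex_cocycle p = list_d (\<lambda>t. if set t \<subseteq> {..r} then simplex_cocycle r t else 0)"
    by (simp add: Suc fun_eq_iff)
  then show ?thesis
    by (simp add: list_d_list_d)
qed

text \<open>A list missing the top vertex does not see the extension by zero, so the smaller cocycle
  being closed suffices. If another vertex is missing, every face misses it too and induction
  applies.\<close>

lemma simplex_cocycle_boundary:
  assumes "j \<le> p" "j \<notin> set s" "set s \<subseteq> {..p}"
  shows "simplex_cocycle p s = 0"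
  using assms
proof (induction p arbitrary: s)
  case 0
  then show ?case
    by auto
next
  case (Suc p)
  show ?case
  proof (cases "j = Suc p")
    case True
    then have s: "set s \<subseteq> {..p}"
      using Suc.prems by (auto simp: le_Suc_eq)
    then have "simplex_cocycle (Suc p) s = list_d (simplex_cocycle p) s"
      unfolding simplex_cocycle.simps using order.trans[OF set_omit_subset s]
      by (intro list_d_cong) simp
    then show ?thesis
      using s by (simp add: simplex_cocycle_closed)
  next
    case False
    moreover have "j \<notin> set (omit i s)" for i
      using Suc.prems(2) set_omit_subset[of i s] by blast
    ultimately show ?thesis
      using Suc.prems Suc.IH by (auto intro!: list_d_eq_0)
  qed
qed

text \<open>Only the face without the last vertex lies in the smaller simplex, so passing from p to
  p + 1 changes the value at most by a sign.\<close>

lemma simplex_cocycle_upt: "simplex_cocycle p [0..<Suc p] \<noteq> 0"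
proof (induction p)
  case (Suc p)
  let ?g = "\<lambda>t. if set t \<subseteq> {..p} then simplex_cocycle p t else 0"
  have *: "?g (omit j [0..<Suc (Suc p)]) = 0" if "j < Suc p" for j
  proof -
    have "Suc p \<in> set (omit j [0..<Suc (Suc p)])"
      using that by (simp add: omit_def del: upt_Suc)
    then show ?thesis
      by (auto simp del: upt_Suc)
  qed
  have "omit (Suc p) [0..<Suc (Suc p)] = [0..<Suc p]"
    by (simp add: omit_def)
  moreover have "{0..<Suc p} \<subseteq> {..p}"
    by auto
  ultimately have "simplex_cocycle (Suc p) [0..<Suc (Suc p)]
      = (- 1) ^ Suc p * simplex_cocycle p [0..<Suc p]"
    using * by (simp add: list_d_def sum.lessThan_Suc del: upt_Suc)
  then show ?case
    using Suc by (simp del: upt_Suc)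
qed simp

section \<open>Graded pieces of the Cech complex\<close>

lemma lookup_sign:
  fixes f :: laurent
  shows "Poly_Mapping.lookup ((- 1) ^ j * f) m = (- 1) ^ j * Poly_Mapping.lookup f m"
  by (cases "even j") simp_all

lemma lookup_cech_d:
  assumes "s \<in> simplices n (Suc p)"
  shows "Poly_Mapping.lookup (cech_d n p \<phi> s) m = list_d (\<lambda>t. Poly_Mapping.lookup (\<phi> t) m) s"
proof -
  have "length s = Suc (Suc p)"
    using assms by (simp add: simplices_def)
  then show ?thesis
    using assms by (simp add: cech_d_def list_d_def lookup_sum lookup_sign lessThan_Suc_atMost
        del: sum.atMost_Suc sum.lessThan_Suc)
qed

text \<open>The vanishing conditions say that \<open>f s\<close> times the character of
  \<open>m\<close> is a section over the intersection of the cones in \<open>s\<close>. Thus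
  \<open>f\<close> is a cocycle concentrated in degree \<open>m\<close>, and \<open>g\<close> is the
  degree-\<open>m\<close> coefficient of a Cech cochain with that coboundary.\<close>

lemma cohomology_zero_graded:
  assumes "cohomology_zero n D (Suc p)" "m \<in> char_lattice n"
    and f0: "\<And>s \<rho>. s \<in> simplices n (Suc p) \<Longrightarrow> pairing n m \<rho> + D \<rho> < 0 \<Longrightarrow>
      \<forall>\<sigma> \<in> set s. \<rho> \<in> \<sigma> \<Longrightarrow> f s = 0"
    and fd: "\<And>s. s \<in> simplices n (Suc (Suc p)) \<Longrightarrow> list_d f s = 0"
  obtains g :: "ray set list \<Rightarrow> complex" where
    "\<And>s \<rho>. s \<in> simplices n p \<Longrightarrow> pairing n m \<rho> + D \<rho> < 0 \<Longrightarrow>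
      \<forall>\<sigma> \<in> set s. \<rho> \<in> \<sigma> \<Longrightarrow> g s = 0"
    "\<And>s. s \<in> simplices n (Suc p) \<Longrightarrow> list_d g s = f s"
proof -
  define \<phi> where "\<phi> s = (if s \<in> simplices n (Suc p) then Poly_Mapping.single m (f s) else 0)" for s
  have look: "Poly_Mapping.lookup (\<phi> s) m' = (if m' = m \<and> s \<in> simplices n (Suc p) then f s else 0)"
    for s m'
    by (auto simp: \<phi>_def lookup_single when_def)
  have "\<phi> s \<in> sections n D (\<Inter>(set s))" if s: "s \<in> simplices n (Suc p)" for s
  proof (cases "f s = 0")
    case True
    then show ?thesis
      using s by (simp add: \<phi>_def sections_zero)
  next
    case False
    then have "pairing n m \<rho> + D \<rho> \<ge> 0" if "\<rho> \<in> \<Inter>(set s)" for \<rho>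
      using f0[OF s, of \<rho>] that by (meson InterE linorder_not_le)
    then show ?thesis
      using s assms(2) by (auto simp: \<phi>_def sections_def laurent_ring_def)
  qed
  then have "\<phi> \<in> cochains n D (Suc p)"
    by (simp add: cochains_def \<phi>_def)
  moreover have "cech_d n (Suc p) \<phi> s = 0" for s
  proof (cases "s \<in> simplices n (Suc (Suc p))")
    case True
    show ?thesis
    proof (rule poly_mapping_eqI)
      fix m'
      have "Poly_Mapping.lookup (cech_d n (Suc p) \<phi> s) m' = (if m' = m then list_d f s else 0)"
        unfolding lookup_cech_d[OF True] using omit_simplices[OF True] True
        by (auto simp: look simplices_def intro!: list_d_cong list_d_eq_0)
      then show "Poly_Mapping.lookup (cech_d n (Suc p) \<phi> s) m' = Poly_Mapping.lookup 0 m'"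
        using fd[OF True] by simp
    qed
  qed (simp add: cech_d_def)
  ultimately have "\<phi> \<in> cocycles n D (Suc p)"
    by (auto simp: cocycles_def)
  then obtain \<psi> where \<psi>: "\<psi> \<in> cochains n D p" "\<phi> = cech_d n p \<psi>"
    using assms(1) by (auto simp: cohomology_zero_def)
  show ?thesis
  proof (rule that[of "\<lambda>s. Poly_Mapping.lookup (\<psi> s) m"])
    fix s \<rho>
    assume s: "s \<in> simplices n p" and \<rho>: "pairing n m \<rho> + D \<rho> < 0" "\<forall>\<sigma> \<in> set s. \<rho> \<in> \<sigma>"
    have "\<psi> s \<in> sections n D (\<Inter>(set s))"
      using \<psi>(1) s by (simp add: cochains_def)
    moreover have "\<rho> \<in> \<Inter>(set s)"
      using \<rho>(2) by blast
    ultimately have "m \<notin> Poly_Mapping.keys (\<psi> s)"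
      using \<rho>(1) unfolding sections_def by fastforce
    then show "Poly_Mapping.lookup (\<psi> s) m = 0"
      by (simp add: in_keys_iff)
  next
    fix s
    assume s: "s \<in> simplices n (Suc p)"
    show "list_d (\<lambda>s. Poly_Mapping.lookup (\<psi> s) m) s = f s"
      using lookup_cech_d[OF s, of \<psi> m] s by (simp add: \<psi>(2)[symmetric] look)
  qed
qed

text \<open>
  The labelling \<open>q\<close> is a simplicial map from the nerve of the stars of the rays with negative
  coefficient to the boundary of a simplex, along which the fundamental cocycle is pulled back.
\<close>

lemma cohomology_nonzero:
  assumes m: "m \<in> char_lattice n" and p: "p > 0"
    and q: "\<And>\<sigma>. \<sigma> \<in> max_cones n \<Longrightarrow> q \<sigma> \<le> p"
    and miss: "\<And>\<rho>. pairing n m \<rho> + D \<rho> < 0 \<Longrightarrow> \<exists>j\<le>p. \<forall>\<sigma> \<in> max_cones n. \<rho> \<in> \<sigma> \<longrightarrow> q \<sigma> \<noteq> j"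
    and x: "\<And>i. i \<le> p \<Longrightarrow> x i \<in> max_cones n" "\<And>i. i \<le> p \<Longrightarrow> q (x i) = i"
    and facet: "\<And>j. j \<le> p \<Longrightarrow> \<exists>\<rho>. pairing n m \<rho> + D \<rho> < 0 \<and> (\<forall>i\<le>p. i \<noteq> j \<longrightarrow> \<rho> \<in> x i)"
  shows "\<not> cohomology_zero n D p"
proof
  assume H: "cohomology_zero n D p"
  obtain r where r: "p = Suc r"
    using p gr0_implies_Suc by blast
  define f where "f s = simplex_cocycle p (map q s)" for s
  have qs: "set (map q s) \<subseteq> {..p}" if "s \<in> simplices n p'" for s p'
    using that q by (auto simp: simplices_def)
  have f0: "f s = 0" if s: "s \<in> simplices n (Suc r)" and \<rho>: "pairing n m \<rho> + D \<rho> < 0"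
    "\<forall>\<sigma> \<in> set s. \<rho> \<in> \<sigma>" for s \<rho>
  proof -
    obtain j where "j \<le> p" "\<forall>\<sigma> \<in> max_cones n. \<rho> \<in> \<sigma> \<longrightarrow> q \<sigma> \<noteq> j"
      using miss[OF \<rho>(1)] by blast
    then have "j \<le> p" "j \<notin> set (map q s)"
      using s \<rho>(2) by (auto simp: simplices_def)
    then show ?thesis
      unfolding f_def using simplex_cocycle_boundary[of j p] qs[OF s] by blast
  qed
  have fd: "list_d f s = 0" if "s \<in> simplices n (Suc (Suc r))" for s
    unfolding f_def list_d_map using qs[OF that] by (rule simplex_cocycle_closed)
  obtain g where g: "\<And>s \<rho>. s \<in> simplices n r \<Longrightarrow> pairing n m \<rho> + D \<rho> < 0 \<Longrightarrow>
      \<forall>\<sigma> \<in> set s. \<rho> \<in> \<sigma> \<Longrightarrow> g s = 0"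
    "\<And>s. s \<in> simplices n (Suc r) \<Longrightarrow> list_d g s = f s"
  proof (rule cohomology_zero_graded[OF H[unfolded r] m, of f], goal_cases)
    case (3 g)
    from 3(2,3) show ?case
      by (rule 3(1))
  qed (rule f0 fd; assumption)+
  \<comment> \<open>Here the differential of \<open>g\<close> is zero, as each face lies in the star
    of a negative ray, whereas \<open>f\<close> is nonzero, as the labels are 0, ..., p in
    order.\<close>
  let ?s = "map x [0..<Suc p]"
  have s: "?s \<in> simplices n (Suc r)"
    using x(1) by (auto simp: simplices_def r less_Suc_eq_le simp del: upt_Suc)
  have "list_d g ?s = 0"
  proof (rule list_d_eq_0)
    fix j assume "j < length ?s"
    then have j: "j \<le> p" by simp
    obtain \<rho> where \<rho>: "pairing n m \<rho> + D \<rho> < 0" "\<forall>i\<le>p. i \<noteq> j \<longrightarrow> \<rho> \<in> x i"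
      using facet[OF j] by blast
    show "g (omit j ?s) = 0"
    proof (rule g(1)[OF omit_simplices[OF s] \<rho>(1)], safe)
      show "j \<le> Suc r" using j r by simp
      fix \<sigma> assume "\<sigma> \<in> set (omit j ?s)"
      then obtain l where "l < length ?s" "l \<noteq> j" "\<sigma> = ?s ! l"
        by (rule in_set_omit)
      then show "\<rho> \<in> \<sigma>"
        using \<rho>(2) by (simp add: nth_append less_Suc_eq_le del: upt_Suc)
    qed
  qed
  moreover have "map q ?s = [0..<Suc p]"
    using x(2) by (intro nth_equalityI) (simp_all del: upt_Suc)
  then have "f ?s \<noteq> 0"
    unfolding f_def using simplex_cocycle_upt[of p] by simp
  ultimately show False
    using g(2)[OF s] by simp
qed

text \<open>A prism argument: the entries \<open>x' i\<close> are exchanged for \<open>x i\<close>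
  one at a time. All faces but two of the intermediate list \<open>c\<close> lie in the star of a
  ray of \<open>J\<close>, so closedness equates the values on these two.\<close>

lemma cocycle_replace:
  assumes closed: "\<And>s. s \<in> simplices n (Suc p) \<Longrightarrow> list_d \<theta> s = 0"
    and van: "\<And>s \<rho>. s \<in> simplices n p \<Longrightarrow> \<rho> \<in> J \<Longrightarrow> \<forall>\<sigma> \<in> set s. \<rho> \<in> \<sigma> \<Longrightarrow> \<theta> s = 0"
    and x: "\<And>i. i \<le> p \<Longrightarrow> x i \<in> max_cones n" "\<And>i. i \<le> p \<Longrightarrow> x' i \<in> max_cones n"
    and facet: "\<And>j. j \<le> p \<Longrightarrow> \<exists>\<rho> \<in> J. \<forall>i\<le>p. i \<noteq> j \<longrightarrow> \<rho> \<in> x i \<and> \<rho> \<in> x' i"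
  shows "\<theta> (map x [0..<Suc p]) = (\<theta> (map x' [0..<Suc p]) :: complex)"
proof -
  define b where "b i = map x [0..<i] @ map x' [i..<Suc p]" for i
  have step: "\<theta> (b i) = \<theta> (b (Suc i))" if i: "i \<le> p" for i
  proof -
    define c where "c = map x [0..<Suc i] @ map x' [i..<Suc p]"
    have len: "length c = Suc (Suc p)"
      using i by (simp add: c_def del: upt_Suc)
    have c: "c \<in> simplices n (Suc p)"
      using x i unfolding simplices_def mem_Collect_eq len
      by (auto simp: c_def less_Suc_eq_le simp del: upt_Suc)
    have nth: "c ! l = (if l \<le> i then x l else x' (l - 1))" if "l < Suc (Suc p)" for l
      using that i by (auto simp: c_def nth_append simp del: upt_Suc)
    have zero: "\<theta> (omit k c) = 0" if k: "k < Suc (Suc p)" "k \<noteq> i" "k \<noteq> Suc i" for k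
    proof -
      \<comment> \<open>Past position i the entries of \<open>c\<close> are shifted by one;
        \<open>k'\<close> is the index of the omitted cone, which differs from the doubled index
        i.\<close>
      define k' where "k' = (if k \<le> i then k else k - 1)"
      have "k' \<le> p"
        using k i by (auto simp: k'_def)
      then obtain \<rho> where \<rho>: "\<rho> \<in> J" "\<forall>i\<le>p. i \<noteq> k' \<longrightarrow> \<rho> \<in> x i \<and> \<rho> \<in> x' i"
        using facet by blast
      show ?thesis
      proof (rule van[OF omit_simplices[OF c] \<rho>(1)], safe)
        show "k \<le> Suc p" using k by simp
        fix \<sigma> assume "\<sigma> \<in> set (omit k c)"
        then obtain l where "l < length c" "l \<noteq> k" "\<sigma> = c ! l"
          by (rule in_set_omit)
        then show "\<rho> \<in> \<sigma>"
          using \<rho>(2) k i by (auto simp: nth len k'_def split: if_splits)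
      qed
    qed
    have "omit i c = b i"
      using i by (simp add: omit_def c_def b_def)
    moreover have "omit (Suc i) c = b (Suc i)"
      using i by (simp add: omit_def c_def b_def drop_map del: upt_Suc)
    moreover have "list_d \<theta> c = (\<Sum>j\<in>{i, Suc i}. (- 1) ^ j * \<theta> (omit j c))"
      unfolding list_d_def len using zero i by (intro sum.mono_neutral_right) auto
    ultimately have "(- 1) ^ i * (\<theta> (b i) - \<theta> (b (Suc i))) = 0"
      using closed[OF c] by (simp add: algebra_simps)
    then show ?thesis
      by simp
  qed
  have "i \<le> Suc p \<Longrightarrow> \<theta> (b 0) = \<theta> (b i)" for i
    by (induction i) (use step in auto)
  from this[of "Suc p"] show ?thesis
    by (simp add: b_def)
qed

section \<open>Maximal cones\<close>

lemma max_cone_excl: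
  assumes "\<sigma> \<in> max_cones n"
  shows "\<not> (Rz \<in> \<sigma> \<and> Rt \<in> \<sigma>)" "\<not> (Rt \<in> \<sigma> \<and> Ru \<in> \<sigma>)" "\<not> (Ru \<in> \<sigma> \<and> Rv \<in> \<sigma>)"
    "\<not> insert Rz (y_rays n) \<subseteq> \<sigma>" "\<not> insert Rv (y_rays n) \<subseteq> \<sigma>"
proof -
  have "\<forall>P \<in> primitive_collections n. \<not> P \<subseteq> \<sigma>"
    using assms by (simp add: max_cones_def cones_def)
  then show "\<not> (Rz \<in> \<sigma> \<and> Rt \<in> \<sigma>)" "\<not> (Rt \<in> \<sigma> \<and> Ru \<in> \<sigma>)" "\<not> (Ru \<in> \<sigma> \<and> Rv \<in> \<sigma>)"
    "\<not> insert Rz (y_rays n) \<subseteq> \<sigma>" "\<not> insert Rv (y_rays n) \<subseteq> \<sigma>"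
    by (simp_all add: primitive_collections_def)
qed

lemma ex_primitive:
  "(\<exists>P \<in> primitive_collections n. P \<subseteq> X) \<longleftrightarrow> (Rv \<in> X \<or> Rz \<in> X) \<and> y_rays n \<subseteq> X \<or>
     Rz \<in> X \<and> Rt \<in> X \<or> Rt \<in> X \<and> Ru \<in> X \<or> Ru \<in> X \<and> Rv \<in> X"
  by (auto simp: primitive_collections_def)

text \<open>A subset of a cone is a cone, so it suffices to test maximality by adding single
  rays.\<close>

lemma max_conesI:
  assumes "\<sigma> \<subseteq> rays n" "\<not> (\<exists>P \<in> primitive_collections n. P \<subseteq> \<sigma>)"
    "\<And>\<rho>. \<rho> \<in> rays n \<Longrightarrow> \<rho> \<notin> \<sigma> \<Longrightarrow> \<exists>P \<in> primitive_collections n. P \<subseteq> insert \<rho> \<sigma>"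
  shows "\<sigma> \<in> max_cones n"
proof -
  have "\<tau> = \<sigma>" if \<tau>: "\<tau> \<in> cones n" "\<sigma> \<subseteq> \<tau>" for \<tau>
  proof (rule ccontr)
    assume "\<tau> \<noteq> \<sigma>"
    then obtain \<rho> where \<rho>: "\<rho> \<in> \<tau>" "\<rho> \<notin> \<sigma>"
      using \<tau>(2) by blast
    then have "\<rho> \<in> rays n"
      using \<tau>(1) by (auto simp: cones_def)
    then obtain P where "P \<in> primitive_collections n" "P \<subseteq> insert \<rho> \<sigma>"
      using assms(3) \<rho>(2) by blast
    moreover have "insert \<rho> \<sigma> \<subseteq> \<tau>"
      using \<rho>(1) \<tau>(2) by simp
    ultimately show False
      using \<tau>(1) unfolding cones_def by blast
  qed
  then show ?thesis
    using assms(1,2) unfolding max_cones_def cones_def by blast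
qed

lemma ray_notin_y_rays [simp]:
  "Rz \<notin> y_rays n" "Rt \<notin> y_rays n" "Ru \<notin> y_rays n" "Rv \<notin> y_rays n"
  by (auto simp: y_rays_def)

lemma Ry_in_y_rays [simp]: "Ry i \<in> y_rays n \<longleftrightarrow> i \<in> {1..n - 1}"
  by (auto simp: y_rays_def)

lemma max_cone_y:
  assumes "\<rho> \<in> {Rt, Ru}"
  shows "insert \<rho> (y_rays n) \<in> max_cones n"
proof (rule max_conesI)
  show "insert \<rho> (y_rays n) \<subseteq> rays n"
    using assms by (auto simp: rays_def)
  show "\<not> (\<exists>P \<in> primitive_collections n. P \<subseteq> insert \<rho> (y_rays n))"
    using assms by (auto simp: ex_primitive)
  fix x assume "x \<in> rays n" "x \<notin> insert \<rho> (y_rays n)"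
  then have "x \<in> {Rz, Rt, Ru, Rv}" "x \<noteq> \<rho>"
    by (auto simp: rays_def)
  moreover have "y_rays n \<subseteq> insert x (insert \<rho> (y_rays n))"
    by blast
  ultimately show "\<exists>P \<in> primitive_collections n. P \<subseteq> insert x (insert \<rho> (y_rays n))"
    unfolding ex_primitive using assms by (elim insertE emptyE) simp_all
qed

text \<open>Once one \<open>Ry i\<close> is missing, only the exclusions z-t, t-u, u-v remain. They
  form a path, and the three pairs are its maximal independent sets.\<close>

lemma max_cone_omit_y:
  assumes i: "i \<in> {1..n - 1}" and \<rho>: "(\<rho>, \<rho>') \<in> {(Ru, Rz), (Rv, Rz), (Rv, Rt)}"
  shows "{\<rho>, \<rho>'} \<union> (y_rays n - {Ry i}) \<in> max_cones n" (is "?\<sigma> \<in> _")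
proof (rule max_conesI)
  have "Ry i \<in> y_rays n"
    using i by simp
  moreover have "Ry i \<notin> ?\<sigma>"
    using \<rho> by auto
  ultimately have y: "\<not> y_rays n \<subseteq> ?\<sigma>"
    by blast
  show "?\<sigma> \<subseteq> rays n"
    using \<rho> by (auto simp: rays_def)
  show "\<not> (\<exists>P \<in> primitive_collections n. P \<subseteq> ?\<sigma>)"
    unfolding ex_primitive using \<rho> y by (elim insertE emptyE) simp_all
  fix x assume x: "x \<in> rays n" "x \<notin> ?\<sigma>"
  show "\<exists>P \<in> primitive_collections n. P \<subseteq> insert x ?\<sigma>"
  proof (cases "x = Ry i")
    case True
    then have "y_rays n \<subseteq> insert x ?\<sigma>"
      by blast
    then show ?thesis
      unfolding ex_primitive using \<rho> by (elim insertE emptyE) simp_all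
  next
    case False
    then have "x \<in> {Rz, Rt, Ru, Rv}"
      using x by (auto simp: rays_def)
    then show ?thesis
      unfolding ex_primitive using \<rho> x(2) by (elim insertE emptyE) simp_all
  qed
qed

text \<open>For \<open>r\<close> one of \<open>Rz\<close>, \<open>Rv\<close>, the rays \<open>facet_ray r i\<close>, \<open>i < n\<close>, form a primitive collection.\<close>

definition facet_ray :: "ray \<Rightarrow> nat \<Rightarrow> ray" where
  "facet_ray r i = (if i = 0 then r else Ry i)"

text \<open>The labelling for \<open>cohomology_nonzero\<close>: a cone never contains the whole
  primitive collection, and a cone through \<open>facet_ray r i\<close> never gets the label i. Any
  choice of a missing member would do; the least one is taken.\<close>

definition missing :: "ray \<Rightarrow> ray set \<Rightarrow> nat" where
  "missing r \<sigma> = (LEAST i. facet_ray r i \<notin> \<sigma>)"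

lemma missing:
  assumes "\<sigma> \<in> max_cones n" "n \<ge> 2" "r \<in> {Rz, Rv}"
  shows "missing r \<sigma> \<le> n - 1" "facet_ray r (missing r \<sigma>) \<notin> \<sigma>"
proof -
  have "\<not> insert r (y_rays n) \<subseteq> \<sigma>"
    using max_cone_excl(4,5)[OF assms(1)] assms(3) by auto
  then have "\<exists>i \<le> n - 1. facet_ray r i \<notin> \<sigma>"
    unfolding y_rays_def facet_ray_def by fastforce
  then obtain i where i: "i \<le> n - 1" "facet_ray r i \<notin> \<sigma>"
    by blast
  show "missing r \<sigma> \<le> n - 1"
    unfolding missing_def using Least_le[of "\<lambda>i. facet_ray r i \<notin> \<sigma>", OF i(2)] i(1) by simp
  show "facet_ray r (missing r \<sigma>) \<notin> \<sigma>"
    unfolding missing_def using i(2) by (rule LeastI)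
qed

lemma missing_eq_0: "r \<notin> \<sigma> \<Longrightarrow> missing r \<sigma> = 0"
  unfolding missing_def by (rule Least_equality) (simp_all add: facet_ray_def)

lemma missing_eq:
  assumes "facet_ray r i \<notin> \<sigma>" "\<And>j. j < i \<Longrightarrow> facet_ray r j \<in> \<sigma>"
  shows "missing r \<sigma> = i"
  unfolding missing_def using assms by (intro Least_equality) (auto simp: not_less[symmetric])

lemma missing_omit_y:
  assumes "i \<in> {1..n - 1}" "{\<rho>, \<rho>'} \<inter> y_rays n = {}" "r \<in> {\<rho>, \<rho>'}"
  shows "missing r ({\<rho>, \<rho>'} \<union> (y_rays n - {Ry i})) = i"
  by (rule missing_eq) (use assms in \<open>auto simp: facet_ray_def\<close>)

section \<open>Nonvanishing cohomology\<close>

text \<open>The degree in which \<open>a D\<^sub>y + b D\<^sub>t + c D\<^sub>u\<close> has the divisor with coefficients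
  \<open>y\<close>, \<open>z\<close>, \<open>b - z\<close>, \<open>c - v\<close>, \<open>v\<close>; a negative \<open>y\<close> is distributed over all the \<open>D\<^bsub>y i\<^esub>\<close>.\<close>

lemma degree_exists:
  assumes n: "n \<ge> 2" and a: "a = y + z + v" and y: "y \<ge> 0 \<or> y \<le> - int (n - 1)"
  obtains m where "m \<in> char_lattice n"
    "\<And>i. i \<in> {1..n - 1} \<Longrightarrow> pairing n m (Ry i) + line_bundle (a, b, c) (Ry i) < 0 \<longleftrightarrow> y < 0"
    "pairing n m Rz + line_bundle (a, b, c) Rz = z"
    "pairing n m Rt + line_bundle (a, b, c) Rt = b - z"
    "pairing n m Ru + line_bundle (a, b, c) Ru = c - v"
    "pairing n m Rv + line_bundle (a, b, c) Rv = v"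
proof -
  \<comment> \<open>For y < 0 the rays \<open>Ry i\<close> with 1 < i < n get coefficient -1 and
    \<open>Ry 1\<close> the remaining y + n - 2, which is negative because y is at most -(n -
    1).\<close>
  define e :: int where "e = (if y < 0 then - 1 else 0)"
  define g where "g i = (if i = n then z else if i = 1 then y - e * (int n - 2) - a
    else if i \<in> {1..n} then e else 0)" for i
  have "finite {i. g i \<noteq> 0}"
    by (rule finite_subset[of _ "{1..n}"]) (use n in \<open>auto simp: g_def\<close>)
  then have look: "Poly_Mapping.lookup (Abs_poly_mapping g) = g"
    by (simp add: Abs_poly_mapping_inverse)
  have "{1..n} = insert 1 (insert n {2..<n})"
    using n by auto
  then have "(\<Sum>i = 1..n. g i) = g 1 + (g n + (\<Sum>i = 2..<n. g i))"
    using n by simp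
  also have "(\<Sum>i = 2..<n. g i) = (\<Sum>i = 2..<n. e)"
    by (rule sum.cong) (auto simp: g_def)
  finally have sum: "(\<Sum>i = 1..n. g i) = - v"
    using n a by (simp add: g_def algebra_simps of_nat_diff)
  show ?thesis
  proof (rule that[of "Abs_poly_mapping g"])
    show "Abs_poly_mapping g \<in> char_lattice n"
      using n by (auto simp: char_lattice_def in_keys_iff look g_def split: if_splits)
  qed (use n sum y in \<open>auto simp: pairing_simps look prime_div_def g_def e_def of_nat_diff
      simp del: One_nat_def split: if_splits\<close>)
qed

text \<open>The star of \<open>r\<close> meets the star of no other negative ray, and
  \<open>s\<close> is such a ray, so the subcomplex of negative rays is disconnected. The label
  tells whether a cone lies in the star of \<open>r\<close>.\<close>

lemma H1_nonzero:
  assumes m: "m \<in> char_lattice n"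
    and neg: "pairing n m r + D r < 0" "pairing n m s + D s < 0"
    and x: "x0 \<in> max_cones n" "s \<in> x0" "r \<notin> x0" "x1 \<in> max_cones n" "r \<in> x1"
    and disj: "\<And>\<rho> \<sigma>. pairing n m \<rho> + D \<rho> < 0 \<Longrightarrow> \<rho> \<noteq> r \<Longrightarrow> \<sigma> \<in> max_cones n \<Longrightarrow> \<rho> \<in> \<sigma> \<Longrightarrow> r \<notin> \<sigma>"
  shows "\<not> cohomology_zero n D 1"
proof (rule cohomology_nonzero[OF m, where q = "\<lambda>\<sigma>. if r \<in> \<sigma> then 1 else 0"
      and x = "\<lambda>i. if i = 0 then x0 else x1"])
  show "\<exists>j::nat\<le>1. \<forall>\<sigma> \<in> max_cones n. \<rho> \<in> \<sigma> \<longrightarrow> (if r \<in> \<sigma> then 1 else 0) \<noteq> j"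
    if "pairing n m \<rho> + D \<rho> < 0" for \<rho>
  proof (cases "\<rho> = r")
    case True
    then show ?thesis
      by (intro exI[of _ 0]) simp
  next
    case False
    then show ?thesis
      using disj[OF that] by (intro exI[of _ 1]) auto
  qed
  show "\<exists>\<rho>. pairing n m \<rho> + D \<rho> < 0 \<and> (\<forall>i\<le>1. i \<noteq> j \<longrightarrow> \<rho> \<in> (if i = 0 then x0 else x1))"
    if "j \<le> 1" for j :: nat
  proof (cases "j = 0")
    case True
    then show ?thesis
      using neg(1) x(5) by auto
  next
    case False
    then show ?thesis
      using neg(2) x(2) that by (intro exI[of _ s]) auto
  qed
qed (use x in auto)

text \<open>The primitive collection spans the boundary of a simplex with n vertices, a sphere of
  dimension n - 2, whose class appears in degree n - 1. Cones through any further negative ray avoid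
  \<open>r\<close> and get the label 0, so such rays do not destroy the class.\<close>

lemma sphere_nonzero:
  assumes n: "n \<ge> 2" and m: "m \<in> char_lattice n" and r: "r \<in> {Rz, Rv}"
    and neg: "pairing n m r + D r < 0" "\<And>i. i \<in> {1..n - 1} \<Longrightarrow> pairing n m (Ry i) + D (Ry i) < 0"
    and disj: "\<And>\<rho> \<sigma>. pairing n m \<rho> + D \<rho> < 0 \<Longrightarrow> \<rho> \<notin> insert r (y_rays n) \<Longrightarrow>
      \<sigma> \<in> max_cones n \<Longrightarrow> \<rho> \<in> \<sigma> \<Longrightarrow> r \<notin> \<sigma>"
  shows "\<not> cohomology_zero n D (n - 1)"
proof -
  \<comment> \<open>For i > 0 these cones contain both \<open>Rv\<close> and \<open>Rz\<close>, so
    one family serves for both choices of \<open>r\<close>.\<close>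
  define x where "x i = (if i = 0 then insert Rt (y_rays n) else {Rv, Rz} \<union> (y_rays n - {Ry i}))" for i
  show ?thesis
  proof (rule cohomology_nonzero[OF m, where q = "missing r" and x = x])
    show "missing r \<sigma> \<le> n - 1" if "\<sigma> \<in> max_cones n" for \<sigma>
      using missing(1)[OF that n r] .
    show "\<exists>j\<le>n - 1. \<forall>\<sigma> \<in> max_cones n. \<rho> \<in> \<sigma> \<longrightarrow> missing r \<sigma> \<noteq> j"
      if neg\<rho>: "pairing n m \<rho> + D \<rho> < 0" for \<rho>
    proof (cases "\<exists>j \<le> n - 1. \<rho> = facet_ray r j")
      case True
      then show ?thesis
        using missing(2)[OF _ n r] by blast
    next
      case False
      have "\<rho> \<notin> insert r (y_rays n)"
      proof
        assume "\<rho> \<in> insert r (y_rays n)"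
        then have "\<rho> = facet_ray r 0 \<or> (\<exists>i \<in> {1..n - 1}. \<rho> = facet_ray r i)"
          by (auto simp: y_rays_def facet_ray_def)
        then show False
          using False by auto
      qed
      then have "missing r \<sigma> = 0" if "\<sigma> \<in> max_cones n" "\<rho> \<in> \<sigma>" for \<sigma>
        using disj[OF neg\<rho> _ that] by (intro missing_eq_0)
      then show ?thesis
        using n by (intro exI[of _ 1]) auto
    qed
    show "x i \<in> max_cones n" if "i \<le> n - 1" for i
      using that max_cone_y max_cone_omit_y[of i n Rv Rz] by (simp add: x_def)
    show "missing r (x i) = i" if "i \<le> n - 1" for i
    proof (cases "i = 0")
      case True
      then show ?thesis
        unfolding x_def using r by (auto intro!: missing_eq_0)
    next
      case False
      then show ?thesis
        unfolding x_def using that r missing_omit_y[of i n Rv Rz r] by auto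
    qed
    show "\<exists>\<rho>. pairing n m \<rho> + D \<rho> < 0 \<and> (\<forall>i\<le>n - 1. i \<noteq> j \<longrightarrow> \<rho> \<in> x i)" if "j \<le> n - 1" for j
    proof (cases "j = 0")
      case True
      then show ?thesis
        using neg(1) r by (intro exI[of _ r]) (auto simp: x_def)
    next
      case False
      then show ?thesis
        using neg(2)[of j] that by (intro exI[of _ "Ry j"]) (auto simp: x_def)
    qed
  qed (use n in simp)
qed

text \<open>
  When all coefficients are negative, the class is the image of the fundamental cocycle of the
  star of \<open>u\<close> under the connecting homomorphism. The cycle of that star is moved, within the
  nerve of the stars of the other rays, into the star of \<open>t\<close>.
\<close>

lemma top_nonzero:
  assumes n: "n \<ge> 2" and m: "m \<in> char_lattice n"
    and neg: "\<And>\<rho>. \<rho> \<in> rays n \<Longrightarrow> pairing n m \<rho> + D \<rho> < 0"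
  shows "\<not> cohomology_zero n D n"
proof
  assume H: "cohomology_zero n D n"
  obtain p where p: "n = Suc p"
    using n by (cases n) auto
  have rays: "\<rho> \<in> rays n" if "\<rho> \<in> \<sigma>" "\<sigma> \<in> max_cones n" for \<rho> \<sigma>
    using that by (auto simp: max_cones_def cones_def)
  \<comment> \<open>Besides \<open>Ru\<close>, cones through \<open>Ru\<close> contain only
    \<open>Rz\<close> and the y rays, which form a primitive collection; hence the labelling by
    \<open>missing Rz\<close>.\<close>
  define k where "k s = (if \<forall>\<sigma> \<in> set s. Ru \<in> \<sigma> then simplex_cocycle p (map (missing Rz) s) else 0)" for s
  have q: "set (map (missing Rz) s) \<subseteq> {..p}" if "s \<in> simplices n l" for s l
    using that missing(1)[OF _ n, of _ Rz] by (auto simp: simplices_def p)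
  have k0: "k s = 0" if s: "s \<in> simplices n l" and \<rho>: "\<forall>\<sigma> \<in> set s. \<rho> \<in> \<sigma>" "\<rho> \<noteq> Ru" for s l \<rho>
  proof (cases "\<forall>\<sigma> \<in> set s. Ru \<in> \<sigma>")
    case True
    obtain \<sigma> where \<sigma>: "\<sigma> \<in> set s" "\<sigma> \<in> max_cones n"
      using s by (cases s) (auto simp: simplices_def)
    have "\<rho> \<in> insert Rz (y_rays n)"
      using rays[of \<rho> \<sigma>] max_cone_excl[OF \<sigma>(2)] True \<rho> \<sigma> by (auto simp: rays_def)
    then obtain j where j: "j \<le> p" "\<rho> = facet_ray Rz j"
      by (auto simp: facet_ray_def y_rays_def p intro: that[of 0])
    have "j \<notin> set (map (missing Rz) s)"
      using \<rho>(1) j(2) missing(2)[OF _ n, of _ Rz] s by (auto simp: simplices_def)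
    then show ?thesis
      using simplex_cocycle_boundary[OF j(1) _ q[OF s]] by (simp add: k_def)
  qed (auto simp: k_def)
  obtain g where g: "\<And>s \<rho>. s \<in> simplices n p \<Longrightarrow> pairing n m \<rho> + D \<rho> < 0 \<Longrightarrow>
      \<forall>\<sigma> \<in> set s. \<rho> \<in> \<sigma> \<Longrightarrow> g s = 0"
    "\<And>s. s \<in> simplices n (Suc p) \<Longrightarrow> list_d g s = list_d k s"
  proof (rule cohomology_zero_graded[where D = D and p = p and f = "list_d k", OF _ m], goal_cases)
    show "cohomology_zero n D (Suc p)"
      using H p by simp
  next
    fix s \<rho>
    assume s: "s \<in> simplices n (Suc p)" "\<forall>\<sigma> \<in> set s. \<rho> \<in> \<sigma>"
    show "list_d k s = 0"
    proof (cases "\<rho> = Ru")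
      case True
      have "list_d k s = list_d (\<lambda>t. simplex_cocycle p (map (missing Rz) t)) s"
        using s(2) True set_omit_subset[of _ s] by (intro list_d_cong) (auto simp: k_def)
      then show ?thesis
        using simplex_cocycle_closed[OF q[OF s(1)]] by (simp add: list_d_map)
    next
      case False
      show ?thesis
      proof (rule list_d_eq_0)
        fix j assume "j < length s"
        then have "omit j s \<in> simplices n p"
          using omit_simplices[OF s(1)] s(1) by (simp add: simplices_def)
        then show "k (omit j s) = 0"
          using s(2) False set_omit_subset[of j s] by (intro k0) auto
      qed
    qed
  next
    fix s show "list_d (list_d k) s = 0"
      by (rule list_d_list_d)
  next
    case (4 g)
    from 4(2,3) show ?case
      by (rule 4(1))
  qed
  \<comment> \<open>Subtracting \<open>g\<close> makes \<open>k\<close> closed, and the difference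
    still vanishes on the star of every ray other than \<open>Ru\<close>.\<close>
  define \<theta> where "\<theta> s = k s - g s" for s
  define J where "J = {Rz, Rt, Rv} \<union> y_rays n"
  have J: "\<rho> \<in> rays n" "\<rho> \<noteq> Ru" if "\<rho> \<in> J" for \<rho>
    using that by (auto simp: J_def rays_def)
  have closed: "list_d \<theta> s = 0" if "s \<in> simplices n (Suc p)" for s
    using g(2)[OF that] by (simp add: \<theta>_def[abs_def] list_d_diff)
  have van: "\<theta> s = 0" if "s \<in> simplices n p" "\<rho> \<in> J" "\<forall>\<sigma> \<in> set s. \<rho> \<in> \<sigma>" for s \<rho>
    using k0[OF that(1,3)] g(1)[OF that(1) neg that(3)] J[OF that(2)] by (simp add: \<theta>_def)
  define x where "x \<rho> \<rho>1 \<rho>2 i =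
    (if i = 0 then insert \<rho> (y_rays n) else {\<rho>1, \<rho>2} \<union> (y_rays n - {Ry i}))" for \<rho> \<rho>1 \<rho>2 i
  have x: "x \<rho> \<rho>1 \<rho>2 i \<in> max_cones n"
    if "i \<le> p" "\<rho> \<in> {Rt, Ru}" "(\<rho>1, \<rho>2) \<in> {(Ru, Rz), (Rv, Rz), (Rv, Rt)}" for \<rho> \<rho>1 \<rho>2 i
    using that max_cone_y[OF that(2)] max_cone_omit_y[OF _ that(3)] p by (simp add: x_def)
  have y: "\<exists>\<rho> \<in> J. \<forall>i\<le>p. i \<noteq> j \<longrightarrow> \<rho> \<in> x \<rho>0 \<rho>1 \<rho>2 i \<and> \<rho> \<in> x \<rho>0' \<rho>1' \<rho>2' i"
    if "\<rho> \<in> J" "\<rho> \<in> {\<rho>1, \<rho>2}" "\<rho> \<in> {\<rho>1', \<rho>2'}" "j \<le> p" for \<rho> \<rho>0 \<rho>1 \<rho>2 \<rho>0' \<rho>1' \<rho>2' j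
  proof (cases "j = 0")
    case True
    then show ?thesis
      using that by (intro bexI[of _ \<rho>]) (auto simp: x_def)
  next
    case False
    then show ?thesis
      using that p by (intro bexI[of _ "Ry j"]) (auto simp: x_def J_def)
  qed
  \<comment> \<open>Two moves lead from the star of \<open>Ru\<close> to that of \<open>Rt\<close>:
    the first keeps \<open>Rz\<close> in all cones with i > 0, the second keeps \<open>Rv\<close>. A
    face omitting some j > 0 stays in the star of \<open>Ry j\<close>.\<close>
  have "\<theta> (map (x Ru Ru Rz) [0..<Suc p]) = \<theta> (map (x Rt Rv Rz) [0..<Suc p])"
  proof (rule cocycle_replace[OF closed van])
    show "\<exists>\<rho> \<in> J. \<forall>i\<le>p. i \<noteq> j \<longrightarrow> \<rho> \<in> x Ru Ru Rz i \<and> \<rho> \<in> x Rt Rv Rz i" if "j \<le> p" for j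
      using that by (intro y[of Rz]) (simp_all add: J_def)
  qed (auto intro!: x)
  also have "\<dots> = \<theta> (map (x Rt Rv Rt) [0..<Suc p])"
  proof (rule cocycle_replace[OF closed van])
    show "\<exists>\<rho> \<in> J. \<forall>i\<le>p. i \<noteq> j \<longrightarrow> \<rho> \<in> x Rt Rv Rz i \<and> \<rho> \<in> x Rt Rv Rt i" if "j \<le> p" for j
      using that by (intro y[of Rv]) (simp_all add: J_def)
  qed (auto intro!: x)
  also have "\<dots> = 0"
  proof (rule van[of _ Rt])
    show "map (x Rt Rv Rt) [0..<Suc p] \<in> simplices n p"
      using x[of _ Rt Rv Rt] by (auto simp: simplices_def simp del: upt_Suc)
  qed (auto simp: J_def x_def)
  finally have "\<theta> (map (x Ru Ru Rz) [0..<Suc p]) = 0" .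
  moreover have "g (map (x Ru Ru Rz) [0..<Suc p]) = 0"
  proof (rule g(1))
    show "map (x Ru Ru Rz) [0..<Suc p] \<in> simplices n p"
      using x[of _ Ru Ru Rz] by (auto simp: simplices_def simp del: upt_Suc)
    show "pairing n m Ru + D Ru < 0"
      by (rule neg) (simp add: rays_def)
  qed (auto simp: x_def)
  moreover have "k (map (x Ru Ru Rz) [0..<Suc p]) \<noteq> 0"
  proof -
    have "missing Rz (x Ru Ru Rz i) = i" if "i \<le> p" for i
    proof (cases "i = 0")
      case True
      then show ?thesis
        by (simp add: x_def missing_eq_0)
    next
      case False
      then show ?thesis
        using that missing_omit_y[of i n Ru Rz Rz] p by (simp add: x_def)
    qed
    then have "map (missing Rz) (map (x Ru Ru Rz) [0..<Suc p]) = [0..<Suc p]"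
      by (intro nth_equalityI) (simp_all del: upt_Suc)
    moreover have "\<forall>\<sigma> \<in> set (map (x Ru Ru Rz) [0..<Suc p]). Ru \<in> \<sigma>"
      by (auto simp: x_def)
    ultimately show ?thesis
      unfolding k_def using simplex_cocycle_upt[of p] by presburger
  qed
  ultimately show False
    by (simp add: \<theta>_def)
qed

section \<open>Counting\<close>

text \<open>
  The clauses exclude, in this order, differences with nonzero \<open>H\<^sup>1\<close> (three times), \<open>H\<^bsup>n - 1\<^esup>\<close> (twice)
  and \<open>H\<^sup>n\<close>.
\<close>

definition allowed :: "nat \<Rightarrow> int \<Rightarrow> int \<Rightarrow> int \<Rightarrow> bool" where
  "allowed n a b c \<longleftrightarrow>
     \<not> (b \<le> - 2 \<and> a \<ge> b + 1) \<and> \<not> (c \<le> - 2 \<and> a \<ge> c + 1) \<and>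
     \<not> (b \<ge> - 1 \<and> c \<ge> - 1 \<and> a \<ge> b + c + 2) \<and>
     \<not> (b \<ge> 0 \<and> a \<le> b - int n) \<and> \<not> (c \<ge> 0 \<and> a \<le> c - int n) \<and>
     \<not> (b \<le> - 2 \<and> c \<le> - 2 \<and> a \<le> - int n - 1)"

definition admissible :: "nat \<Rightarrow> (int \<times> int \<times> int) set \<Rightarrow> bool" where
  "admissible n S \<longleftrightarrow> (\<forall>a b c a' b' c'. (a, b, c) \<in> S \<longrightarrow> (a', b', c') \<in> S \<longrightarrow>
     allowed n (a' - a) (b' - b) (c' - c))"

text \<open>The fan is symmetric under exchanging z with v and t with u. This allows assuming that
  b, rather than c, is the coordinate growing by exactly one.\<close>

lemma admissible_swap:
  assumes "admissible n S"
  shows "admissible n ((\<lambda>(a, b, c). (a, c, b)) ` S)"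
proof -
  have "allowed n a c b" if "allowed n a b c" for a b c
    using that unfolding allowed_def by linarith
  moreover have "(a, b, c) \<in> (\<lambda>(a, b, c). (a, c, b)) ` S \<longleftrightarrow> (a, c, b) \<in> S" for a b c
    by force
  ultimately show ?thesis
    using assms unfolding admissible_def by presburger
qed

section \<open>Differences of two bundles on one level and on different levels\<close>

lemma admissible_pairD:
  assumes "admissible n S" "(a0, b0, c0) \<in> S" "(a1, b1, c1) \<in> S"
  shows "\<not> (b1 - b0 \<le> - 2 \<and> a1 - a0 \<ge> b1 - b0 + 1)" "\<not> (c1 - c0 \<le> - 2 \<and> a1 - a0 \<ge> c1 - c0 + 1)"
    "\<not> (b1 - b0 \<ge> - 1 \<and> c1 - c0 \<ge> - 1 \<and> a1 - a0 \<ge> b1 - b0 + (c1 - c0) + 2)"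
    "\<not> (b1 - b0 \<ge> 0 \<and> a1 - a0 \<le> b1 - b0 - int n)" "\<not> (c1 - c0 \<ge> 0 \<and> a1 - a0 \<le> c1 - c0 - int n)"
    "\<not> (b1 - b0 \<le> - 2 \<and> c1 - c0 \<le> - 2 \<and> a1 - a0 \<le> - int n - 1)"
proof -
  have "allowed n (a1 - a0) (b1 - b0) (c1 - c0)"
    using assms unfolding admissible_def by blast
  then show "\<not> (b1 - b0 \<le> - 2 \<and> a1 - a0 \<ge> b1 - b0 + 1)" "\<not> (c1 - c0 \<le> - 2 \<and> a1 - a0 \<ge> c1 - c0 + 1)"
    "\<not> (b1 - b0 \<ge> - 1 \<and> c1 - c0 \<ge> - 1 \<and> a1 - a0 \<ge> b1 - b0 + (c1 - c0) + 2)"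
    "\<not> (b1 - b0 \<ge> 0 \<and> a1 - a0 \<le> b1 - b0 - int n)" "\<not> (c1 - c0 \<ge> 0 \<and> a1 - a0 \<le> c1 - c0 - int n)"
    "\<not> (b1 - b0 \<le> - 2 \<and> c1 - c0 \<le> - 2 \<and> a1 - a0 \<le> - int n - 1)"
    unfolding allowed_def by blast+
qed

text \<open>The three H^1 clauses, used in both directions, cut out the hexagon formed by zero and
  the six roots of A_2.\<close>

lemma admissible_same_level:
  assumes "admissible n S" "(a, b0, c0) \<in> S" "(a, b1, c1) \<in> S"
  shows "\<bar>b1 - b0\<bar> \<le> 1" "\<bar>c1 - c0\<bar> \<le> 1" "\<bar>b1 - b0 + (c1 - c0)\<bar> \<le> 1"
proof -
  note d = admissible_pairD[OF assms] admissible_pairD[OF assms(1,3,2)]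
  show *: "\<bar>b1 - b0\<bar> \<le> 1" "\<bar>c1 - c0\<bar> \<le> 1"
    using d(1,2,7,8) by linarith+
  show "\<bar>b1 - b0 + (c1 - c0)\<bar> \<le> 1"
    using d(3,9) * by linarith
qed

text \<open>The lower bounds come from the H^1 clauses upwards, the upper bounds by
  \<open>a1 - a0\<close> from those downwards. Downwards, the H^(n-1) clauses force b and c to grow
  once the distance is at least n, and the H^n clause keeps one of them from growing by 2 beyond
  distance n.\<close>

lemma admissible_upper_level:
  assumes "admissible n S" "(a0, b0, c0) \<in> S" "(a1, b1, c1) \<in> S" "a0 < a1"
  shows "b1 - b0 \<ge> - 1" "c1 - c0 \<ge> - 1" "b1 - b0 \<le> a1 - a0" "c1 - c0 \<le> a1 - a0"
    "b1 - b0 + (c1 - c0) \<ge> a1 - a0 - 1"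
    "a1 - a0 \<ge> int n \<Longrightarrow> b1 - b0 \<ge> 1" "a1 - a0 \<ge> int n \<Longrightarrow> c1 - c0 \<ge> 1"
    "a1 - a0 > int n \<Longrightarrow> b1 - b0 \<le> 1 \<or> c1 - c0 \<le> 1"
    "b1 = b0 \<Longrightarrow> a1 - a0 < int n"
proof -
  note d = admissible_pairD[OF assms(1,2,3)] admissible_pairD[OF assms(1,3,2)]
  show bc: "b1 - b0 \<ge> - 1" "c1 - c0 \<ge> - 1"
    using d(1,2) assms(4) by linarith+
  show "b1 - b0 \<le> a1 - a0" "c1 - c0 \<le> a1 - a0"
    using d(7,8) assms(4) by linarith+
  show "b1 - b0 + (c1 - c0) \<ge> a1 - a0 - 1"
    using d(3) bc assms(4) by linarith
  show b: "b1 - b0 \<ge> 1" if "a1 - a0 \<ge> int n"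
    using d(10) bc that by linarith
  show "c1 - c0 \<ge> 1" if "a1 - a0 \<ge> int n"
    using d(11) bc that by linarith
  show "b1 - b0 \<le> 1 \<or> c1 - c0 \<le> 1" if "a1 - a0 > int n"
    using d(12) that by linarith
  show "a1 - a0 < int n" if "b1 = b0"
    using b that by linarith
qed

section \<open>Bundles on one level and on consecutive levels\<close>

definition level :: "(int \<times> int \<times> int) set \<Rightarrow> int \<Rightarrow> (int \<times> int \<times> int) set" where
  "level S a = {P \<in> S. fst P = a}"

text \<open>On a root of A_2 the value of b - c is 1 or 2 up to sign, never a multiple of 3, so the
  residues of b - c separate the bundles of a level.\<close>

lemma card_level_le_3:
  assumes "admissible n S"
  shows "card (level S a) \<le> 3"
proof -
  have "inj_on (\<lambda>(a, b, c). (b - c) mod 3) (level S a)"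
  proof (rule inj_onI)
    fix P Q
    assume P: "P \<in> level S a" and Q: "Q \<in> level S a"
      and eq: "(case P of (a, b, c) \<Rightarrow> (b - c) mod 3) = (case Q of (a, b, c) \<Rightarrow> (b - c) mod 3)"
    obtain b0 c0 where P': "P = (a, b0, c0)" "(a, b0, c0) \<in> S"
      using P by (cases P) (auto simp: level_def)
    obtain b1 c1 where Q': "Q = (a, b1, c1)" "(a, b1, c1) \<in> S"
      using Q by (cases Q) (auto simp: level_def)
    have "(b1 - c1) mod 3 = (b0 - c0) mod 3"
      using eq P' Q' by simp
    then have "3 dvd (b1 - b0) - (c1 - c0)"
      unfolding mod_eq_dvd_iff by (simp add: algebra_simps)
    moreover have "t = 0" if "3 dvd t" "\<bar>t\<bar> \<le> 2" for t :: int
      using that by presburger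
    ultimately have "(b1 - b0) - (c1 - c0) = 0"
      using admissible_same_level(1,2)[OF assms P'(2) Q'(2)] by fastforce
    then have "b0 = b1 \<and> c0 = c1"
      using admissible_same_level(3)[OF assms P'(2) Q'(2)] by linarith
    then show "P = Q"
      using P' Q' by simp
  qed
  moreover have "(\<lambda>(a, b, c). (b - c) mod 3) ` level S a \<subseteq> {0, 1, 2 :: int}"
    by auto
  ultimately have "card (level S a) \<le> card {0, 1, 2 :: int}"
    by (intro card_inj_on_le) auto
  then show ?thesis
    by simp
qed

lemma root_cases:
  fixes x y :: int
  assumes "\<bar>x\<bar> \<le> 1" "\<bar>y\<bar> \<le> 1" "\<bar>x + y\<bar> \<le> 1" "x \<noteq> 0 \<or> y \<noteq> 0"
  shows "(x, y) \<in> {(1, 0), (- 1, 0), (0, 1), (0, - 1), (1, - 1), (- 1, 1)}"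
proof -
  have "x \<in> {- 1, 0, 1}" "y \<in> {- 1, 0, 1}"
    using assms(1,2) by auto
  then show ?thesis
    using assms(3,4) by (elim insertE emptyE) simp_all
qed

text \<open>Three points pairwise differing by roots form an elementary triangle of the lattice, in
  one of two orientations.\<close>

lemma full_level:
  assumes "admissible n S" "card (level S a) = 3"
  obtains b c where "(a, b, c) \<in> S" "(a, b + 1, c) \<in> S" "(a, b, c + 1) \<in> S"
  | b c where "(a, b, c) \<in> S" "(a, b - 1, c) \<in> S" "(a, b, c - 1) \<in> S"
proof -
  obtain P Q R where L: "level S a = {P, Q, R}" "P \<noteq> Q" "P \<noteq> R" "Q \<noteq> R"
    using assms(2) by (auto simp: card_3_iff)
  then have mem: "P \<in> level S a" "Q \<in> level S a" "R \<in> level S a"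
    by auto
  obtain b0 c0 where P: "P = (a, b0, c0)" "(a, b0, c0) \<in> S"
    using mem(1) by (cases P) (auto simp: level_def)
  obtain b1 c1 where Q: "Q = (a, b1, c1)" "(a, b1, c1) \<in> S"
    using mem(2) by (cases Q) (auto simp: level_def)
  obtain b2 c2 where R: "R = (a, b2, c2)" "(a, b2, c2) \<in> S"
    using mem(3) by (cases R) (auto simp: level_def)
  have ne: "b1 \<noteq> b0 \<or> c1 \<noteq> c0" "b2 \<noteq> b0 \<or> c2 \<noteq> c0" "b2 \<noteq> b1 \<or> c2 \<noteq> c1"
    using L(2-4) P Q R by auto
  note d = admissible_same_level[OF assms(1) P(2) Q(2)] admissible_same_level[OF assms(1) P(2) R(2)]
    admissible_same_level[OF assms(1) Q(2) R(2)]
  define x y u v where "x = b1 - b0" and "y = c1 - c0" and "u = b2 - b0" and "v = c2 - c0"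
  have xy: "(x, y) \<in> {(1, 0), (- 1, 0), (0, 1), (0, - 1), (1, - 1), (- 1, 1)}"
    by (rule root_cases) (use d(1-3) ne(1) in \<open>simp_all add: x_def y_def\<close>)
  have uv: "(u, v) \<in> {(1, 0), (- 1, 0), (0, 1), (0, - 1), (1, - 1), (- 1, 1)}"
    by (rule root_cases) (use d(4-6) ne(2) in \<open>simp_all add: u_def v_def\<close>)
  have diff: "\<bar>u - x\<bar> \<le> 1" "\<bar>v - y\<bar> \<le> 1" "\<bar>u - x + (v - y)\<bar> \<le> 1" "(u, v) \<noteq> (x, y)"
    using d(7-9) ne(3) by (simp_all add: x_def y_def u_def v_def)
  have mem: "(i, j) \<in> insert (0, 0) {(x, y), (u, v)} \<Longrightarrow> (a, b0 + i, c0 + j) \<in> S" for i j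
    using P(2) Q(2) R(2) by (auto simp: x_def y_def u_def v_def)
  \<comment> \<open>Two roots whose difference is a root are neighbours on the hexagon. Each
    orientation arises from three of the six neighbouring pairs, according to the vertex that
    \<open>P\<close> is.\<close>
  consider "{(x, y), (u, v)} = {(1, 0), (0, 1)}"
    | "{(x, y), (u, v)} = {(- 1, 0), (0, - 1)}"
    | "{(x, y), (u, v)} = {(1, 0), (1, - 1)}"
    | "{(x, y), (u, v)} = {(0, 1), (- 1, 1)}"
    | "{(x, y), (u, v)} = {(- 1, 0), (- 1, 1)}"
    | "{(x, y), (u, v)} = {(0, - 1), (1, - 1)}"
    using xy uv diff by (elim insertE emptyE) (simp_all add: doubleton_eq_iff)
  then show ?thesis
  proof cases
    case 1
    then show ?thesis
      using mem[of 0 0] mem[of "1" "0"] mem[of "0" "1"]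
      by (intro that(1)[of "b0" "c0"]) simp_all
  next
    case 2
    then show ?thesis
      using mem[of 0 0] mem[of "- 1" "0"] mem[of "0" "- 1"]
      by (intro that(2)[of "b0" "c0"]) simp_all
  next
    case 3
    then show ?thesis
      using mem[of 0 0] mem[of "1" "0"] mem[of "1" "- 1"]
      by (intro that(2)[of "b0 + 1" "c0"]) simp_all
  next
    case 4
    then show ?thesis
      using mem[of 0 0] mem[of "0" "1"] mem[of "- 1" "1"]
      by (intro that(2)[of "b0" "c0 + 1"]) simp_all
  next
    case 5
    then show ?thesis
      using mem[of 0 0] mem[of "- 1" "0"] mem[of "- 1" "1"]
      by (intro that(1)[of "b0 + (- 1)" "c0"]) simp_all
  next
    case 6
    then show ?thesis
      using mem[of 0 0] mem[of "0" "- 1"] mem[of "1" "- 1"]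
      by (intro that(1)[of "b0" "c0 + (- 1)"]) simp_all
  qed
qed

text \<open>One level up, b and c grow by at most one and b + c does not decrease. Comparing extreme
  vertices rules out every pair of orientations except the first below and the second above.\<close>

lemma full_consecutive_levels:
  assumes "admissible n S" "card (level S a) = 3" "card (level S (a + 1)) = 3"
  shows "\<exists>b c. (a, b, c) \<in> S \<and> (a, b + 1, c) \<in> S \<and> (a, b, c + 1) \<in> S"
    and "\<exists>b c. (a + 1, b, c) \<in> S \<and> (a + 1, b - 1, c) \<in> S \<and> (a + 1, b, c - 1) \<in> S"
proof -
  have step: "b' - b \<le> 1" "c' - c \<le> 1" "b' - b + (c' - c) \<ge> 0"
    if "(a, b, c) \<in> S" "(a + 1, b', c') \<in> S" for b b' c c'
    using admissible_upper_level(3-5)[OF assms(1) that] by simp_all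
  have "(\<exists>b c. (a, b, c) \<in> S \<and> (a, b + 1, c) \<in> S \<and> (a, b, c + 1) \<in> S) \<and>
      (\<exists>b c. (a + 1, b, c) \<in> S \<and> (a + 1, b - 1, c) \<in> S \<and> (a + 1, b, c - 1) \<in> S)"
  proof (rule full_level[OF assms(1,2)])
    fix b c
    assume lo: "(a, b, c) \<in> S" "(a, b + 1, c) \<in> S" "(a, b, c + 1) \<in> S"
    show ?thesis
    proof (rule full_level[OF assms(1,3)])
      fix b' c'
      assume up: "(a + 1, b', c') \<in> S" "(a + 1, b' + 1, c') \<in> S" "(a + 1, b', c' + 1) \<in> S"
      show ?thesis
        using step(1)[OF lo(1) up(2)] step(2)[OF lo(1) up(3)] step(3)[OF lo(2) up(1)] by linarith
    qed (use lo in blast)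
  next
    fix b c
    assume lo: "(a, b, c) \<in> S" "(a, b - 1, c) \<in> S" "(a, b, c - 1) \<in> S"
    show ?thesis
    proof (rule full_level[OF assms(1,3)])
      fix b' c'
      assume up: "(a + 1, b', c') \<in> S" "(a + 1, b' + 1, c') \<in> S" "(a + 1, b', c' + 1) \<in> S"
      show ?thesis
        using step(1)[OF lo(2) up(2)] step(2)[OF lo(3) up(3)] step(3)[OF lo(1) up(1)] by linarith
    next
      fix b' c'
      assume up: "(a + 1, b', c') \<in> S" "(a + 1, b' - 1, c') \<in> S" "(a + 1, b', c' - 1) \<in> S"
      show ?thesis
        using step(1)[OF lo(2) up(1)] step(2)[OF lo(3) up(1)] step(3)[OF lo(1) up(2)] by linarith
    qed
  qed
  then show "\<exists>b c. (a, b, c) \<in> S \<and> (a, b + 1, c) \<in> S \<and> (a, b, c + 1) \<in> S"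
    "\<exists>b c. (a + 1, b, c) \<in> S \<and> (a + 1, b - 1, c) \<in> S \<and> (a + 1, b, c - 1) \<in> S"
    by blast+
qed

text \<open>The middle level would have both orientations at once, being the upper level of one full
  pair and the lower level of another.\<close>

lemma three_levels_not_full:
  assumes "admissible n S" "card (level S a) = 3" "card (level S (a + 1)) = 3"
  shows "card (level S (a + 2)) \<noteq> 3"
proof
  assume "card (level S (a + 2)) = 3"
  then have *: "card (level S (a + 1 + 1)) = 3"
    by (simp add: add.assoc)
  obtain b c where up: "(a + 1, b, c) \<in> S" "(a + 1, b + 1, c) \<in> S" "(a + 1, b, c + 1) \<in> S"
    using full_consecutive_levels(1)[OF assms(1,3) *] by blast
  obtain b' c' where down: "(a + 1, b', c') \<in> S" "(a + 1, b' - 1, c') \<in> S" "(a + 1, b', c' - 1) \<in> S"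
    using full_consecutive_levels(2)[OF assms] by blast
  show False
    using admissible_same_level(1)[OF assms(1) down(2) up(2)]
      admissible_same_level(2)[OF assms(1) down(3) up(3)]
      admissible_same_level[OF assms(1) down(1) up(1)] by linarith
qed

text \<open>The constant 2 absorbs the levels left over by blocks of three: two levels may hold 6
  bundles, and 3 * 6 = 8 * 2 + 2.\<close>

lemma card_consecutive_levels:
  assumes "admissible n S" "finite S"
  shows "3 * card {P \<in> S. a \<le> fst P \<and> fst P < a + int m} \<le> 8 * m + 2"
proof (induction m rule: less_induct)
  case (less m)
  have fin: "finite (level S x)" for x
    using assms(2) by (simp add: level_def)
  note le3 = card_level_le_3[OF assms(1)]
  consider "m = 0" | "m = 1" | "m = 2" | k where "m = Suc (Suc (Suc k))"
    by (metis One_nat_def Suc_1 not0_implies_Suc)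
  then show ?case
  proof cases
    case 1
    then have *: "{P \<in> S. a \<le> fst P \<and> fst P < a + int m} = {}"
      by auto
    show ?thesis
      unfolding * by simp
  next
    case 2
    then have "{P \<in> S. a \<le> fst P \<and> fst P < a + int m} = level S a"
      by (auto simp: level_def)
    then show ?thesis
      using le3[of a] 2 by simp
  next
    case 3
    then have *: "{P \<in> S. a \<le> fst P \<and> fst P < a + int m} = level S a \<union> level S (a + 1)"
      by (auto simp: level_def)
    have "card (level S a \<union> level S (a + 1)) \<le> 6"
      using le3[of a] le3[of "a + 1"] by (intro order.trans[OF card_Un_le]) linarith
    then show ?thesis
      unfolding * using 3 by simp
  next
    case (4 k)
    let ?x = "a + int k"
    define L where "L = {P \<in> S. a \<le> fst P \<and> fst P < ?x}"
    have "P \<in> {P \<in> S. a \<le> fst P \<and> fst P < a + int m} \<longleftrightarrow>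
        P \<in> L \<union> (level S ?x \<union> (level S (?x + 1) \<union> level S (?x + 2)))" for P
    proof -
      have "a \<le> fst P \<and> fst P < a + int m \<longleftrightarrow> a \<le> fst P \<and> fst P < ?x \<or>
          fst P = ?x \<or> fst P = ?x + 1 \<or> fst P = ?x + 2"
        using 4 by linarith
      then show ?thesis
        unfolding L_def level_def by blast
    qed
    then have "{P \<in> S. a \<le> fst P \<and> fst P < a + int m} =
        L \<union> (level S ?x \<union> (level S (?x + 1) \<union> level S (?x + 2)))"
      by (rule set_eqI)
    also have "card \<dots> \<le>
        card L + (card (level S ?x) + (card (level S (?x + 1)) + card (level S (?x + 2))))"
      by (intro order.trans[OF card_Un_le] add_left_mono card_Un_le)
    finally have "card {P \<in> S. a \<le> fst P \<and> fst P < a + int m} \<le> \<dots>" .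
    moreover have "card (level S ?x) + (card (level S (?x + 1)) + card (level S (?x + 2))) \<le> 8"
    proof (rule ccontr)
      assume "\<not> ?thesis"
      then have "card (level S ?x) = 3" "card (level S (?x + 1)) = 3" "card (level S (?x + 2)) = 3"
        using le3[of ?x] le3[of "?x + 1"] le3[of "?x + 2"] by linarith+
      then show False
        using three_levels_not_full[OF assms(1)] by blast
    qed
    moreover have "3 * card L \<le> 8 * k + 2"
      unfolding L_def using less.IH[of k] 4 by simp
    ultimately show ?thesis
      using 4 by linarith
  qed
qed

text \<open>
  In such a slice \<open>c - a\<close> takes at most two values, and the larger one never occurs on a higher
  level than the smaller one.
\<close>

lemma card_slice:
  assumes adm: "admissible n S" and fin: "finite T" and TS: "T \<subseteq> S"
    and b: "\<And>P. P \<in> T \<Longrightarrow> fst (snd P) = b"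
  shows "card T \<le> card (fst ` T) + 1"
proof (cases "T = {}")
  case False
  define w :: "int \<times> int \<times> int \<Rightarrow> int" where "w = (\<lambda>(a, b, c). c - a)"
  define \<mu> where "\<mu> = Min (w ` T)"
  have pair: "fst P < fst Q \<Longrightarrow> w Q = w P \<or> w Q = w P - 1"
    "fst P = fst Q \<Longrightarrow> \<bar>w Q - w P\<bar> \<le> 1" if P: "P \<in> T" and Q: "Q \<in> T" for P Q
  proof -
    obtain a c where P': "P = (a, b, c)" "(a, b, c) \<in> S"
      using P TS b[OF P] by (cases P) auto
    obtain a' c' where Q': "Q = (a', b, c')" "(a', b, c') \<in> S"
      using Q TS b[OF Q] by (cases Q) auto
    show "w Q = w P \<or> w Q = w P - 1" if "fst P < fst Q"
      using admissible_upper_level(4,5)[OF adm P'(2) Q'(2)] that unfolding P' Q' w_def by auto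
    show "\<bar>w Q - w P\<bar> \<le> 1" if "fst P = fst Q"
      using admissible_same_level(2)[OF adm, of a b c b c'] P'(2) Q'(2) that
      unfolding P'(1) Q'(1) w_def by auto
  qed
  have inj: "inj_on fst {P \<in> T. w P = x}" for x
  proof (rule inj_onI)
    fix P Q
    assume "P \<in> {P \<in> T. w P = x}" "Q \<in> {P \<in> T. w P = x}" "fst P = fst Q"
    then show "P = Q"
      using b[of P] b[of Q] by (cases P; cases Q) (auto simp: w_def)
  qed
  have "\<mu> \<in> w ` T"
    unfolding \<mu>_def using fin False by (intro Min_in) auto
  then obtain P0 where P0: "P0 \<in> T" "w P0 = \<mu>"
    by blast
  have "w P = \<mu> \<or> w P = \<mu> + 1" if "P \<in> T" for P
  proof -
    have "w P \<ge> \<mu>"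
      unfolding \<mu>_def using fin that by simp
    moreover have "w P \<le> \<mu> + 1"
      using pair[OF P0(1) that] pair[OF that P0(1)] P0(2) by linarith
    ultimately show ?thesis
      by linarith
  qed
  then have T: "T = {P \<in> T. w P = \<mu>} \<union> {P \<in> T. w P = \<mu> + 1}"
    by blast
  define A where "A = fst ` {P \<in> T. w P = \<mu>}"
  define B where "B = fst ` {P \<in> T. w P = \<mu> + 1}"
  have fAB: "finite A" "finite B"
    using fin by (simp_all add: A_def B_def)
  have "card T = card {P \<in> T. w P = \<mu>} + card {P \<in> T. w P = \<mu> + 1}"
    by (subst T, rule card_Un_disjoint) (use fin in auto)
  also have "\<dots> = card A + card B"
    unfolding A_def B_def by (simp add: card_image inj)
  also have "\<dots> = card (A \<union> B) + card (A \<inter> B)"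
    using fAB by (rule card_Un_Int)
  also have "A \<union> B = fst ` T"
    unfolding A_def B_def using T by blast
  \<comment> \<open>Of two levels carrying both values of \<open>w\<close>, the lower would carry
    \<open>\<mu>\<close> and the upper \<open>\<mu> + 1\<close>, contrary to
    \<open>pair\<close>.\<close>
  also have "card (A \<inter> B) \<le> 1"
  proof -
    have no: "\<not> x < y" if xy: "x \<in> A" "y \<in> B" for x y
    proof
      assume "x < y"
      obtain P Q where "P \<in> T" "w P = \<mu>" "fst P = x" "Q \<in> T" "w Q = \<mu> + 1" "fst Q = y"
        using xy unfolding A_def B_def by blast
      then show False
        using pair(1)[of P Q] \<open>x < y\<close> by simp
    qed
    then have "x = y" if "x \<in> A \<inter> B" "y \<in> A \<inter> B" for x y
      using that by (metis IntD1 IntD2 linorder_neqE_linordered_idom)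
    then show ?thesis
      using fAB by (simp add: card_le_Suc0_iff_eq)
  qed
  finally show ?thesis
    by simp
qed simp

section \<open>Balancing the lowest levels against those beyond distance n\<close>

text \<open>With k = \<open>card K\<close>, the k lowest levels and the k top levels are slices of
  at most k + 1 bundles each. The n + 1 - k levels between satisfy the bound by blocks of three, and
  6 (k + 1) + 8 (n + 1 - k) + 2 + 2 k = 8 n + 16.\<close>

lemma card_admissible_top:
  assumes n: "n \<ge> 4" and adm: "admissible n S" and fin: "finite S"
    and P0: "(a0, b0, c0) \<in> S" and min: "\<And>P. P \<in> S \<Longrightarrow> a0 \<le> fst P"
    and A: "(aM, b0 + 1, cM) \<in> S" "aM > a0 + int n" and max: "\<And>P. P \<in> S \<Longrightarrow> fst P \<le> aM"
    and K: "K = {a \<in> fst ` S. a > a0 + int n}"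
  shows "3 * card S + 2 * card K \<le> 8 * n + 16"
proof -
  define Top where "Top = {P \<in> S. fst P > a0 + int n}"
  define Low where "Low = {P \<in> S. fst P < a0 + int (card K)}"
  define Mid where "Mid = {P \<in> S. a0 + int (card K) \<le> fst P \<and>
    fst P < a0 + int (card K) + int (n + 1 - card K)}"
  have bTop: "fst (snd P) = b0 + 1" if "P \<in> Top" for P
  proof -
    obtain a b c where Peq: "P = (a, b, c)"
      by (cases P)
    have P: "P = (a, b, c)" "(a, b, c) \<in> S" "a > a0 + int n" "a \<le> aM"
      using that max[of P] Peq by (auto simp: Top_def)
    have lt: "a0 < a"
      using P by linarith
    note up = admissible_upper_level[OF adm P0 P(2) lt]
    have "b = b0 + 1"
    \<comment> \<open>Otherwise c grows by at most 1 from the bottom, so b must grow by at least n -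
      1 >= 3; comparison with the bundle on level \<open>aM\<close> allows only 2.\<close>
    proof (rule ccontr)
      assume "b \<noteq> b0 + 1"
      moreover have "b - b0 \<ge> 1" "b - b0 \<le> 1 \<or> c - c0 \<le> 1"
        using up(6,8) P(3) by linarith+
      ultimately have "b - b0 \<ge> int n - 1"
        using up(5) P(3) by linarith
      moreover have "b \<le> b0 + 2"
      proof (cases "a = aM")
        case True
        then show ?thesis
          using admissible_same_level(1)[OF adm, of a b c "b0 + 1" cM] P(2) A(1) by simp
      next
        case False
        then show ?thesis
          using admissible_upper_level(1)[OF adm P(2) A(1)] P(4) by linarith
      qed
      ultimately show False
        using n by linarith
    qed
    then show ?thesis
      by (simp add: P)
  qed
  have fK: "finite K"
    using fin by (simp add: K)
  \<comment> \<open>Bundles with the same b lie fewer than n levels apart, so k is at most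
    n.\<close>
  have "K \<subseteq> {aM - int n + 1..aM}"
  proof
    fix a assume "a \<in> K"
    then obtain b c where P: "(a, b, c) \<in> S" "a > a0 + int n"
      by (auto simp: K)
    then have "b = b0 + 1" "a \<le> aM"
      using bTop[of "(a, b, c)"] max[of "(a, b, c)"] by (auto simp: Top_def)
    then show "a \<in> {aM - int n + 1..aM}"
      using admissible_upper_level(9)[OF adm P(1) A(1)] n by (cases "a = aM") auto
  qed
  then have "card K \<le> card {aM - int n + 1..aM}"
    by (rule card_mono[rotated]) simp
  then have kn: "card K \<le> n"
    by simp
  \<comment> \<open>This puts every level of \<open>Low\<close> more than n below \<open>aM\<close>,
    where the H^n clause applies.\<close>
  have "K \<subseteq> {a0 + int n + 1..aM}"
    using max by (auto simp: K)
  then have "card K \<le> card {a0 + int n + 1..aM}"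
    by (rule card_mono[rotated]) simp
  then have ka: "int (card K) \<le> aM - a0 - int n"
    using A(2) by simp
  have a0M: "a0 < aM"
    using A(2) by linarith
  have bLow: "fst (snd P) = b0" if "P \<in> Low" for P
  proof -
    obtain a b c where Peq: "P = (a, b, c)"
      by (cases P)
    have P: "P = (a, b, c)" "(a, b, c) \<in> S" "a < a0 + int (card K)" "a0 \<le> a"
      using that min[of P] Peq by (auto simp: Low_def)
    have lt: "a < aM"
      using P(3) ka by linarith
    note up = admissible_upper_level[OF adm P(2) A(1) lt]
    \<comment> \<open>Near the bottom c is still small, while at \<open>aM\<close> it is large
      because b has grown by one only. So c grows by more than 1 from \<open>P\<close> to the top,
      and b must grow by exactly one.\<close>
    have "c - c0 \<le> max (a - a0) 1"
    proof (cases "a = a0")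
      case True
      then show ?thesis
        using admissible_same_level(2)[OF adm P0, of b c] P(2) by simp
    next
      case False
      then show ?thesis
        using admissible_upper_level(4)[OF adm P0 P(2)] P(4) by linarith
    qed
    moreover have "cM - c0 \<ge> aM - a0 - 2"
      using admissible_upper_level(5)[OF adm P0 A(1) a0M] by linarith
    ultimately have "cM - c > 1"
      using P(3,4) ka n A(2) by linarith
    then have "b = b0"
      using up(6,8) P(3) ka by linarith
    then show ?thesis
      by (simp add: P)
  qed
  have "card Top \<le> card (fst ` Top) + 1"
    by (rule card_slice[OF adm _ _ bTop]) (use fin in \<open>auto simp: Top_def\<close>)
  moreover have "fst ` Top = K"
    by (auto simp: Top_def K image_iff)
  moreover have "card Low \<le> card (fst ` Low) + 1"
    by (rule card_slice[OF adm _ _ bLow]) (use fin in \<open>auto simp: Low_def\<close>)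
  moreover have "card (fst ` Low) \<le> card {a0..<a0 + int (card K)}"
    by (rule card_mono) (use min in \<open>auto simp: Low_def\<close>)
  moreover have "3 * card Mid \<le> 8 * (n + 1 - card K) + 2"
    unfolding Mid_def by (rule card_consecutive_levels[OF adm fin])
  moreover have "card S \<le> card Low + (card Mid + card Top)"
  proof -
    have "S = Low \<union> (Mid \<union> Top)"
      unfolding Low_def Mid_def Top_def using kn by auto
    then have "card S \<le> card Low + card (Mid \<union> Top)"
      using card_Un_le[of Low "Mid \<union> Top"] by simp
    then show ?thesis
      using card_Un_le[of Mid Top] by linarith
  qed
  ultimately show ?thesis
    using kn by simp
qed

text \<open>If \<open>K\<close> is empty, the bundles occupy n + 1 consecutive levels. Otherwise a
  bundle on the highest level exceeds \<open>b0\<close> or \<open>c0\<close> by exactly one, and the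
  second case reduces to the first by symmetry.\<close>

lemma card_admissible:
  assumes n: "n \<ge> 4" and adm: "admissible n S" and fin: "finite S" "S \<noteq> {}"
    and a0: "a0 = Min (fst ` S)"
  shows "3 * card S + 2 * card {a \<in> fst ` S. a > a0 + int n} \<le> 8 * n + 16"
proof -
  define K where "K = {a \<in> fst ` S. a > a0 + int n}"
  have min: "a0 \<le> fst P" if "P \<in> S" for P
    using fin that by (simp add: a0)
  obtain b0 c0 where P0: "(a0, b0, c0) \<in> S"
    using Min_in[of "fst ` S"] fin unfolding a0[symmetric] by fastforce
  show ?thesis
  proof (cases "K = {}")
    case True
    then have "S = {P \<in> S. a0 \<le> fst P \<and> fst P < a0 + int (n + 1)}"
      using min by (force simp: K_def)
    then have "3 * card S \<le> 8 * (n + 1) + 2"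
      using card_consecutive_levels[OF adm fin(1), of a0 "n + 1"] by simp
    then show ?thesis
      unfolding K_def[symmetric] True by simp
  next
    case False
    define aM where "aM = Max (fst ` S)"
    have max: "fst P \<le> aM" if "P \<in> S" for P
      using fin that by (simp add: aM_def)
    obtain bM cM where A: "(aM, bM, cM) \<in> S"
      using Max_in[of "fst ` S"] fin unfolding aM_def[symmetric] by fastforce
    have aM: "aM > a0 + int n"
      using False max by (force simp: K_def)
    then have "a0 < aM"
      by linarith
    note up = admissible_upper_level[OF adm P0 A this]
    have "bM = b0 + 1 \<or> cM = c0 + 1"
      using up(6-8) aM by linarith
    then show ?thesis
    proof
      assume "bM = b0 + 1"
      then show ?thesis
        using card_admissible_top[OF n adm fin(1) P0 min _ aM max refl] A by simp
    next
      assume c: "cM = c0 + 1"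
      let ?sw = "\<lambda>(a, b, c). (a, c, b) :: int \<times> int \<times> int"
      have fst: "fst (?sw P) = fst P" for P
        by (cases P) simp
      have "(a0, c0, b0) \<in> ?sw ` S" "(aM, c0 + 1, bM) \<in> ?sw ` S"
        using P0 A c by force+
      then have "3 * card (?sw ` S) + 2 * card {a \<in> fst ` ?sw ` S. a > a0 + int n} \<le> 8 * n + 16"
        using fin min max aM by (intro card_admissible_top[OF n admissible_swap[OF adm]])
          (auto simp: fst)
      moreover have "card (?sw ` S) = card S"
        by (rule card_image) (auto simp: inj_on_def)
      ultimately show ?thesis
        by (simp add: image_image fst)
    qed
  qed
qed

section \<open>Strongly exceptional collections\<close>

text \<open>In each region a is split as y + z + v so that the negative rays contain a primitive
  collection, or are all rays. The bound on a is what \<open>degree_exists\<close> demands of y, and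
  a ray of undetermined sign always spans no cone with the distinguished ray
  \<open>r\<close>.\<close>

lemma acyclic_allowed:
  assumes n: "n \<ge> 3" and acyclic: "\<And>i. i > 0 \<Longrightarrow> cohomology_zero n (line_bundle (a, b, c)) i"
  shows "allowed n a b c"
proof -
  let ?D = "line_bundle (a, b, c)"
  have n2: "n \<ge> 2"
    using n by simp
  have cone: "{\<rho>, \<rho>'} \<union> (y_rays n - {Ry 1}) \<in> max_cones n"
    if "(\<rho>, \<rho>') \<in> {(Ru, Rz), (Rv, Rz), (Rv, Rt)}" for \<rho> \<rho>'
    using max_cone_omit_y[OF _ that, of 1] n by simp
  have rays: "\<rho> \<in> y_rays n \<or> \<rho> \<in> {Rz, Rt, Ru, Rv}" if "\<sigma> \<in> max_cones n" "\<rho> \<in> \<sigma>" for \<rho> \<sigma>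
    using that by (auto simp: max_cones_def cones_def rays_def)
  \<comment> \<open>Negative are z and t, and u if c < 0; neither z nor u shares a cone with
    t.\<close>
  have 1: "\<not> (b \<le> - 2 \<and> a \<ge> b + 1)"
  proof
    assume A: "b \<le> - 2 \<and> a \<ge> b + 1"
    obtain m where m: "m \<in> char_lattice n"
      "\<And>i. i \<in> {1..n - 1} \<Longrightarrow> pairing n m (Ry i) + ?D (Ry i) < 0 \<longleftrightarrow> a - b - 1 < 0"
      "pairing n m Rz + ?D Rz = b + 1" "pairing n m Rt + ?D Rt = b - (b + 1)"
      "pairing n m Ru + ?D Ru = c - 0" "pairing n m Rv + ?D Rv = 0"
      by (rule degree_exists[OF n2, of a "a - b - 1" "b + 1" 0 b c]) (use A in auto)
    have "\<not> cohomology_zero n ?D 1"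
    proof (rule H1_nonzero[OF m(1), of Rt ?D Rz "{Ru, Rz} \<union> (y_rays n - {Ry 1})"
          "insert Rt (y_rays n)"])
      show "Rt \<notin> \<sigma>" if "pairing n m \<rho> + ?D \<rho> < 0" "\<rho> \<noteq> Rt" "\<sigma> \<in> max_cones n" "\<rho> \<in> \<sigma>" for \<rho> \<sigma>
      proof -
        have "\<rho> \<notin> y_rays n" "\<rho> \<noteq> Rv"
          using m(2) m(6) A that(1) by (auto simp: y_rays_def simp del: line_bundle.simps)
        then show ?thesis
          using rays[OF that(3,4)] max_cone_excl[OF that(3)] that(2,4) by blast
      qed
    qed (use m(3-6) A cone[of Ru Rz] max_cone_y[of Rt n] in \<open>simp_all del: line_bundle.simps\<close>)
    then show False
      using acyclic[of 1] by simp
  qed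
  have 2: "\<not> (c \<le> - 2 \<and> a \<ge> c + 1)"
  proof
    assume A: "c \<le> - 2 \<and> a \<ge> c + 1"
    obtain m where m: "m \<in> char_lattice n"
      "\<And>i. i \<in> {1..n - 1} \<Longrightarrow> pairing n m (Ry i) + ?D (Ry i) < 0 \<longleftrightarrow> a - c - 1 < 0"
      "pairing n m Rz + ?D Rz = 0" "pairing n m Rt + ?D Rt = b - 0"
      "pairing n m Ru + ?D Ru = c - (c + 1)" "pairing n m Rv + ?D Rv = c + 1"
      by (rule degree_exists[OF n2, of a "a - c - 1" 0 "c + 1" b c]) (use A in auto)
    have "\<not> cohomology_zero n ?D 1"
    proof (rule H1_nonzero[OF m(1), of Ru ?D Rv "{Rv, Rz} \<union> (y_rays n - {Ry 1})"
          "insert Ru (y_rays n)"])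
      show "Ru \<notin> \<sigma>" if "pairing n m \<rho> + ?D \<rho> < 0" "\<rho> \<noteq> Ru" "\<sigma> \<in> max_cones n" "\<rho> \<in> \<sigma>" for \<rho> \<sigma>
      proof -
        have "\<rho> \<notin> y_rays n" "\<rho> \<noteq> Rz"
          using m(2) m(3) A that(1) by (auto simp: y_rays_def simp del: line_bundle.simps)
        then show ?thesis
          using rays[OF that(3,4)] max_cone_excl[OF that(3)] that(2,4) by blast
      qed
    qed (use m(3-6) A cone[of Rv Rz] max_cone_y[of Ru n] in \<open>simp_all del: line_bundle.simps\<close>)
    then show False
      using acyclic[of 1] by simp
  qed
  \<comment> \<open>Exactly t and u are negative, with coefficient -1.\<close>
  have 3: "\<not> (b \<ge> - 1 \<and> c \<ge> - 1 \<and> a \<ge> b + c + 2)"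
  proof
    assume A: "b \<ge> - 1 \<and> c \<ge> - 1 \<and> a \<ge> b + c + 2"
    obtain m where m: "m \<in> char_lattice n"
      "\<And>i. i \<in> {1..n - 1} \<Longrightarrow> pairing n m (Ry i) + ?D (Ry i) < 0 \<longleftrightarrow> a - b - c - 2 < 0"
      "pairing n m Rz + ?D Rz = b + 1" "pairing n m Rt + ?D Rt = b - (b + 1)"
      "pairing n m Ru + ?D Ru = c - (c + 1)" "pairing n m Rv + ?D Rv = c + 1"
      by (rule degree_exists[OF n2, of a "a - b - c - 2" "b + 1" "c + 1" b c]) (use A in auto)
    have "\<not> cohomology_zero n ?D 1"
    proof (rule H1_nonzero[OF m(1), of Rt ?D Ru "{Ru, Rz} \<union> (y_rays n - {Ry 1})"
          "insert Rt (y_rays n)"])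
      show "Rt \<notin> \<sigma>" if "pairing n m \<rho> + ?D \<rho> < 0" "\<rho> \<noteq> Rt" "\<sigma> \<in> max_cones n" "\<rho> \<in> \<sigma>" for \<rho> \<sigma>
      proof -
        have "\<rho> \<notin> y_rays n" "\<rho> \<noteq> Rz" "\<rho> \<noteq> Rv"
          using m(2) m(3) m(6) A that(1) by (auto simp: y_rays_def simp del: line_bundle.simps)
        then show ?thesis
          using rays[OF that(3,4)] max_cone_excl[OF that(3)] that(2,4) by blast
      qed
    qed (use m(3-6) A cone[of Ru Rz] max_cone_y[of Rt n] in \<open>simp_all del: line_bundle.simps\<close>)
    then show False
      using acyclic[of 1] by simp
  qed
  \<comment> \<open>Negative are v and all y rays; u may be negative too but shares no cone with
    v.\<close>
  have 4: "\<not> (b \<ge> 0 \<and> a \<le> b - int n)"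
  proof
    assume A: "b \<ge> 0 \<and> a \<le> b - int n"
    obtain m where m: "m \<in> char_lattice n"
      "\<And>i. i \<in> {1..n - 1} \<Longrightarrow> pairing n m (Ry i) + ?D (Ry i) < 0 \<longleftrightarrow> a - b + 1 < 0"
      "pairing n m Rz + ?D Rz = b" "pairing n m Rt + ?D Rt = b - b"
      "pairing n m Ru + ?D Ru = c - (- 1)" "pairing n m Rv + ?D Rv = - 1"
      by (rule degree_exists[OF n2, of a "a - b + 1" b "- 1" b c]) (use A n in auto)
    have "\<not> cohomology_zero n ?D (n - 1)"
    proof (rule sphere_nonzero[OF n2 m(1), of Rv])
      show "pairing n m (Ry i) + ?D (Ry i) < 0" if "i \<in> {1..n - 1}" for i
        using m(2)[OF that] A n by linarith
      show "Rv \<notin> \<sigma>" if "pairing n m \<rho> + ?D \<rho> < 0" "\<rho> \<notin> insert Rv (y_rays n)"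
        "\<sigma> \<in> max_cones n" "\<rho> \<in> \<sigma>" for \<rho> \<sigma>
      proof -
        have "\<rho> \<noteq> Rz" "\<rho> \<noteq> Rt"
          using m(3,4) A that(1) by (auto simp del: line_bundle.simps)
        then show ?thesis
          using rays[OF that(3,4)] max_cone_excl[OF that(3)] that(2,4) by blast
      qed
    qed (use m(6) in \<open>simp_all del: line_bundle.simps\<close>)
    then show False
      using acyclic[of "n - 1"] n by simp
  qed
  have 5: "\<not> (c \<ge> 0 \<and> a \<le> c - int n)"
  proof
    assume A: "c \<ge> 0 \<and> a \<le> c - int n"
    obtain m where m: "m \<in> char_lattice n"
      "\<And>i. i \<in> {1..n - 1} \<Longrightarrow> pairing n m (Ry i) + ?D (Ry i) < 0 \<longleftrightarrow> a - c + 1 < 0"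
      "pairing n m Rz + ?D Rz = - 1" "pairing n m Rt + ?D Rt = b - (- 1)"
      "pairing n m Ru + ?D Ru = c - c" "pairing n m Rv + ?D Rv = c"
      by (rule degree_exists[OF n2, of a "a - c + 1" "- 1" c b c]) (use A n in auto)
    have "\<not> cohomology_zero n ?D (n - 1)"
    proof (rule sphere_nonzero[OF n2 m(1), of Rz])
      show "pairing n m (Ry i) + ?D (Ry i) < 0" if "i \<in> {1..n - 1}" for i
        using m(2)[OF that] A n by linarith
      show "Rz \<notin> \<sigma>" if "pairing n m \<rho> + ?D \<rho> < 0" "\<rho> \<notin> insert Rz (y_rays n)"
        "\<sigma> \<in> max_cones n" "\<rho> \<in> \<sigma>" for \<rho> \<sigma>
      proof -
        have "\<rho> \<noteq> Ru" "\<rho> \<noteq> Rv"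
          using m(5,6) A that(1) by (auto simp del: line_bundle.simps)
        then show ?thesis
          using rays[OF that(3,4)] max_cone_excl[OF that(3)] that(2,4) by blast
      qed
    qed (use m(3) in \<open>simp_all del: line_bundle.simps\<close>)
    then show False
      using acyclic[of "n - 1"] n by simp
  qed
  have 6: "\<not> (b \<le> - 2 \<and> c \<le> - 2 \<and> a \<le> - int n - 1)"
  proof
    assume A: "b \<le> - 2 \<and> c \<le> - 2 \<and> a \<le> - int n - 1"
    obtain m where m: "m \<in> char_lattice n"
      "\<And>i. i \<in> {1..n - 1} \<Longrightarrow> pairing n m (Ry i) + ?D (Ry i) < 0 \<longleftrightarrow> a + 2 < 0"
      "pairing n m Rz + ?D Rz = - 1" "pairing n m Rt + ?D Rt = b - (- 1)"
      "pairing n m Ru + ?D Ru = c - (- 1)" "pairing n m Rv + ?D Rv = - 1"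
      by (rule degree_exists[OF n2, of a "a + 2" "- 1" "- 1" b c]) (use A n in auto)
    have "\<forall>\<rho> \<in> rays n. pairing n m \<rho> + ?D \<rho> < 0"
      unfolding ball_rays using m(2-6) A n by (auto simp del: line_bundle.simps)
    then have "\<not> cohomology_zero n ?D n"
      using top_nonzero[OF n2 m(1)] by blast
    then show False
      using acyclic[of n] n by simp
  qed
  show ?thesis
    unfolding allowed_def using 1 2 3 4 5 6 by blast
qed

lemma strongly_exceptional_admissible:
  assumes "n \<ge> 3" "strongly_exceptional n (map line_bundle E)"
  shows "admissible n (set E)"
  unfolding admissible_def
proof (intro allI impI)
  fix a b c a' b' c'
  assume "(a, b, c) \<in> set E" "(a', b', c') \<in> set E"
  then obtain p q where pq: "p < length E" "E ! p = (a, b, c)" "q < length E" "E ! q = (a', b', c')"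
    by (metis in_set_conv_nth)
  show "allowed n (a' - a) (b' - b) (c' - c)"
  proof (rule acyclic_allowed[OF assms(1)])
    fix i :: nat assume "i > 0"
    then have "Ext_zero n i (map line_bundle E ! p) (map line_bundle E ! q)"
      using assms(2) pq(1,3) unfolding strongly_exceptional_def length_map by blast
    then have "Ext_zero n i (line_bundle (a, b, c)) (line_bundle (a', b', c'))"
      by (simp add: pq del: line_bundle.simps)
    moreover have "(\<lambda>\<rho>. line_bundle (a', b', c') \<rho> - line_bundle (a, b, c) \<rho>) =
        line_bundle (a' - a, b' - b, c' - c)"
      by (simp add: fun_eq_iff algebra_simps)
    ultimately show "cohomology_zero n (line_bundle (a' - a, b' - b, c' - c)) i"
      by (simp add: Ext_zero_def del: line_bundle.simps)
  qed
qed

lemma strongly_exceptional_distinct: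
  assumes "strongly_exceptional n (map line_bundle E)"
  shows "distinct E"
proof -
  have "lin_equiv n D D" for D
    unfolding lin_equiv_def
    by (rule bexI[of _ 0]) (simp_all add: pairing_def char_lattice_def)
  then show ?thesis
    using assms unfolding strongly_exceptional_def distinct_conv_nth by (metis length_map nth_map)
qed

theorem theorem3p12:
  fixes n k :: nat and a0 :: int and E :: "(int \<times> int \<times> int) list"
  assumes "n > 20"
    and "E \<noteq> []"
    and "strongly_exceptional n (map line_bundle E)"
    and "a0 = Min (fst ` set E)"
    and "k = card {a \<in> fst ` set E. a > a0 + int n}"
  shows "real (length E) \<le> real k + 1 + 8 / 3 * (real n - real k - 1) + 6 + real k + 2 \<and>
    real k + 1 + 8 / 3 * (real n - real k - 1) + 6 + real k + 2
      \<le> 8 / 3 * real n - 2 / 3 * real k + 19 / 3 \<and>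
    (k \<ge> 1 \<longrightarrow> 8 / 3 * real n - 2 / 3 * real k + 19 / 3 < 3 * real n - 1) \<and>
    real (length E) < 3 * real n - 1"
proof -
  have "length E = card (set E)"
    using strongly_exceptional_distinct[OF assms(3)] by (simp add: distinct_card)
  \<comment> \<open>Divided by 3 this is one better than 8n/3 - 2k/3 + 19/3, the common value of
    both middle expressions. The gain gives |E| < 3n - 1 also for k = 0.\<close>
  moreover have "3 * card (set E) + 2 * k \<le> 8 * n + 16"
    unfolding assms(5) using assms(1,2)
    by (intro card_admissible[OF _ strongly_exceptional_admissible[OF _ assms(3)]] assms(4)) simp_all
  ultimately have "3 * real (length E) + 2 * real k \<le> 8 * real n + 16"
    by linarith
  then show ?thesis
    using assms(1) by (auto simp: field_simps)
qed

end
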